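(* A Banach lattice $E$ has the positive Schur property if and only if $E$ has both the weak Dunford-Pettis property and the positive polynomial Schur property.
   Context: Banach lattices are real. A vector $x$ is called positive if $x\ge 0$. A Banach lattice has the positive Schur property if every weakly null sequence formed by positive vectors is norm null. A Banach lattice $E$ has the weak Dunford-Pettis property if every weakly compact operator from $E$ into any Banach space maps weakly null sequences in $E$ formed by pairwise disjoint vectors to norm null sequences. A scalar-valued $n$-homogeneous polynomial $P$ on $E$ ($n\in\mathbb{N}$) is a map $P(x)=A(x,\dots,x)$ for a (unique) symmetric $n$-linear form $A:E^n\to\mathbb{R}$; $P$ is positive if $A(x_1,\dots,x_n)\ge 0$ whenever $x_1,\dots,x_n\ge 0$; $P$ is regular if it is the difference of two positive $n$-homogeneous polynomials. $E$ has the positive polynomial Schur property if every sequence $(x_j)_{j=1}^\infty$ in $E$ formed by positive vectors such that $P(x_j)\to 0$ for every regular $n$-homogeneous polynomial $P$ on $E$ and every $n\in\mathbb{N}$ is norm null. *)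

theory Defs
  imports
    "HOL-Analysis.Analysis"
    "HOL-Library.Lattice_Algebras"
    "HOL-Combinatorics.Permutations"
begin

section \<open>Banach lattices\<close>

class banach_lattice = banach + ordered_real_vector + lattice_ab_group_add_abs +
  assumes norm_mono_abs: "\<bar>x\<bar> \<le> \<bar>y\<bar> \<Longrightarrow> norm x \<le> norm y"

instance real :: banach_lattice
  by standard simp

definition weakly_null :: "(nat \<Rightarrow> 'a::real_normed_vector) \<Rightarrow> bool" where
  "weakly_null x \<longleftrightarrow> (\<forall>f :: 'a \<Rightarrow> real. bounded_linear f \<longrightarrow> (\<lambda>j. f (x j)) \<longlonglongrightarrow> 0)"

definition pairwise_disjoint_seq :: "(nat \<Rightarrow> 'a::banach_lattice) \<Rightarrow> bool" where
  "pairwise_disjoint_seq x \<longleftrightarrow> (\<forall>i j. i \<noteq> j \<longrightarrow> inf \<bar>x i\<bar> \<bar>x j\<bar> = 0)"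

definition positive_schur_property :: "'a::banach_lattice itself \<Rightarrow> bool" where
  "positive_schur_property _ \<longleftrightarrow>
     (\<forall>x :: nat \<Rightarrow> 'a. (\<forall>j. 0 \<le> x j) \<and> weakly_null x \<longrightarrow> x \<longlonglongrightarrow> 0)"


section \<open>Homogeneous polynomials\<close>

text \<open>
  The argument \<open>(x\<^sub>1, \<dots>, x\<^sub>n)\<close> of an \<open>n\<close>-linear form is represented by a function
  on \<open>nat\<close> of which only the values at \<open>0, \<dots>, n - 1\<close> matter.
\<close>

definition multilinear_form :: "nat \<Rightarrow> ((nat \<Rightarrow> 'a::real_vector) \<Rightarrow> real) \<Rightarrow> bool" where
  "multilinear_form n A \<longleftrightarrow>
     (\<forall>x y. (\<forall>i<n. x i = y i) \<longrightarrow> A x = A y) \<and>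
     (\<forall>i<n. \<forall>x. linear (\<lambda>v. A (x(i := v))))"

definition symmetric_multilinear_form :: "nat \<Rightarrow> ((nat \<Rightarrow> 'a::real_vector) \<Rightarrow> real) \<Rightarrow> bool" where
  "symmetric_multilinear_form n A \<longleftrightarrow>
     multilinear_form n A \<and> (\<forall>\<pi> x. \<pi> permutes {..<n} \<longrightarrow> A (x \<circ> \<pi>) = A x)"

definition polynomial_of_form ::
    "nat \<Rightarrow> ((nat \<Rightarrow> 'a::real_vector) \<Rightarrow> real) \<Rightarrow> ('a \<Rightarrow> real) \<Rightarrow> bool" where
  "polynomial_of_form n A P \<longleftrightarrow>
     symmetric_multilinear_form n A \<and> (\<forall>x. P x = A (\<lambda>_. x))"

definition homogeneous_polynomial :: "nat \<Rightarrow> ('a::real_vector \<Rightarrow> real) \<Rightarrow> bool" where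
  "homogeneous_polynomial n P \<longleftrightarrow> (\<exists>A. polynomial_of_form n A P)"

text \<open>The form \<open>A\<close> in the next definition is determined by \<open>P\<close> (polarization).\<close>

definition positive_polynomial :: "nat \<Rightarrow> ('a::banach_lattice \<Rightarrow> real) \<Rightarrow> bool" where
  "positive_polynomial n P \<longleftrightarrow>
     (\<exists>A. polynomial_of_form n A P \<and> (\<forall>x. (\<forall>i<n. 0 \<le> x i) \<longrightarrow> 0 \<le> A x))"

definition regular_polynomial :: "nat \<Rightarrow> ('a::banach_lattice \<Rightarrow> real) \<Rightarrow> bool" where
  "regular_polynomial n P \<longleftrightarrow>
     homogeneous_polynomial n P \<and>
     (\<exists>Q R. positive_polynomial n Q \<and> positive_polynomial n R \<and> (\<forall>x. P x = Q x - R x))"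

definition positive_polynomial_schur_property :: "'a::banach_lattice itself \<Rightarrow> bool" where
  "positive_polynomial_schur_property _ \<longleftrightarrow>
     (\<forall>x :: nat \<Rightarrow> 'a.
        (\<forall>j. 0 \<le> x j) \<and>
        (\<forall>n\<ge>1. \<forall>P. regular_polynomial n P \<longrightarrow> (\<lambda>j. P (x j)) \<longlonglongrightarrow> 0)
        \<longrightarrow> x \<longlonglongrightarrow> 0)"


section \<open>Banach spaces with an explicit carrier\<close>

text \<open>
  The weak Dunford-Pettis property quantifies over all Banach spaces inside a formula.
  Type classes do not allow this, so target spaces are given by a carrier set and
  operations.
\<close>

record 'v normed_structure =
  pts :: "'v set"
  vadd :: "'v \<Rightarrow> 'v \<Rightarrow> 'v"
  vzero :: 'v
  vscale :: "real \<Rightarrow> 'v \<Rightarrow> 'v"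
  vnorm :: "'v \<Rightarrow> real"

definition vdist :: "'v normed_structure \<Rightarrow> 'v \<Rightarrow> 'v \<Rightarrow> real" where
  "vdist F u v = vnorm F (vadd F u (vscale F (-1) v))"

locale banach_space =
  fixes F :: "'v normed_structure"
  assumes zero_closed: "vzero F \<in> pts F"
    and add_closed: "\<lbrakk>u \<in> pts F; v \<in> pts F\<rbrakk> \<Longrightarrow> vadd F u v \<in> pts F"
    and scale_closed: "u \<in> pts F \<Longrightarrow> vscale F a u \<in> pts F"
    and add_assoc: "\<lbrakk>u \<in> pts F; v \<in> pts F; w \<in> pts F\<rbrakk> \<Longrightarrow>
          vadd F (vadd F u v) w = vadd F u (vadd F v w)"
    and add_comm: "\<lbrakk>u \<in> pts F; v \<in> pts F\<rbrakk> \<Longrightarrow> vadd F u v = vadd F v u"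
    and add_zero: "u \<in> pts F \<Longrightarrow> vadd F u (vzero F) = u"
    and add_neg: "u \<in> pts F \<Longrightarrow> vadd F u (vscale F (-1) u) = vzero F"
    and scale_add: "\<lbrakk>u \<in> pts F; v \<in> pts F\<rbrakk> \<Longrightarrow>
          vscale F a (vadd F u v) = vadd F (vscale F a u) (vscale F a v)"
    and add_scale: "u \<in> pts F \<Longrightarrow> vscale F (a + b) u = vadd F (vscale F a u) (vscale F b u)"
    and scale_scale: "u \<in> pts F \<Longrightarrow> vscale F a (vscale F b u) = vscale F (a * b) u"
    and scale_one: "u \<in> pts F \<Longrightarrow> vscale F 1 u = u"
    and norm_nonneg: "u \<in> pts F \<Longrightarrow> 0 \<le> vnorm F u"
    and norm_eq_zero: "u \<in> pts F \<Longrightarrow> vnorm F u = 0 \<longleftrightarrow> u = vzero F"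
    and norm_scale: "u \<in> pts F \<Longrightarrow> vnorm F (vscale F a u) = \<bar>a\<bar> * vnorm F u"
    and norm_triangle: "\<lbrakk>u \<in> pts F; v \<in> pts F\<rbrakk> \<Longrightarrow>
          vnorm F (vadd F u v) \<le> vnorm F u + vnorm F v"
    and complete: "\<lbrakk>\<forall>n. s n \<in> pts F;
          \<forall>\<epsilon>>0. \<exists>N. \<forall>m\<ge>N. \<forall>n\<ge>N. vdist F (s m) (s n) < \<epsilon>\<rbrakk> \<Longrightarrow>
          \<exists>l\<in>pts F. (\<lambda>n. vdist F (s n) l) \<longlonglongrightarrow> 0"

definition vfunctional :: "'v normed_structure \<Rightarrow> ('v \<Rightarrow> real) \<Rightarrow> bool" where
  "vfunctional F f \<longleftrightarrow>
     (\<forall>u\<in>pts F. \<forall>v\<in>pts F. f (vadd F u v) = f u + f v) \<and>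
     (\<forall>a. \<forall>u\<in>pts F. f (vscale F a u) = a * f u) \<and>
     (\<exists>K. \<forall>u\<in>pts F. \<bar>f u\<bar> \<le> K * vnorm F u)"

definition weak_topology :: "'v normed_structure \<Rightarrow> 'v topology" where
  "weak_topology F =
     topology_generated_by {{u \<in> pts F. f u \<in> U} | f U. vfunctional F f \<and> open U}"

definition bounded_operator ::
    "'v normed_structure \<Rightarrow> ('a::real_normed_vector \<Rightarrow> 'v) \<Rightarrow> bool" where
  "bounded_operator F T \<longleftrightarrow>
     (\<forall>x. T x \<in> pts F) \<and>
     (\<forall>x y. T (x + y) = vadd F (T x) (T y)) \<and>
     (\<forall>a x. T (a *\<^sub>R x) = vscale F a (T x)) \<and>
     (\<exists>K. \<forall>x. vnorm F (T x) \<le> K * norm x)"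

definition weakly_compact_operator ::
    "'v normed_structure \<Rightarrow> ('a::real_normed_vector \<Rightarrow> 'v) \<Rightarrow> bool" where
  "weakly_compact_operator F T \<longleftrightarrow>
     bounded_operator F T \<and>
     compactin (weak_topology F) (weak_topology F closure_of (T ` cball 0 1))"


section \<open>The weak Dunford-Pettis property\<close>

definition weak_dunford_pettis_into :: "'a::banach_lattice itself \<Rightarrow> 'v itself \<Rightarrow> bool" where
  "weak_dunford_pettis_into _ _ \<longleftrightarrow>
     (\<forall>(F :: 'v normed_structure) (T :: 'a \<Rightarrow> 'v) x.
        banach_space F \<and> weakly_compact_operator F T \<and>
        weakly_null x \<and> pairwise_disjoint_seq x \<longrightarrow>
        (\<lambda>j. vnorm F (T (x j))) \<longlonglongrightarrow> 0)"

text \<open>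
  The Banach spaces \<open>F\<close> below range over all those whose points are taken from the type
  \<open>nat \<Rightarrow> 'a\<close>. Up to renaming of points, these include the closure of the range of every
  operator on \<open>'a\<close>: choose, for each point of the closure, a sequence in \<open>'a\<close> whose image
  converges to it. Theorem \<open>weak_dunford_pettis_any_space\<close> below shows that the definition
  indeed covers the Banach spaces over every type.
\<close>

definition weak_dunford_pettis_property :: "'a::banach_lattice itself \<Rightarrow> bool" where
  "weak_dunford_pettis_property _ \<longleftrightarrow>
     weak_dunford_pettis_into TYPE('a) TYPE(nat \<Rightarrow> 'a)"


subsection \<open>Independence of the choice of type\<close>

text \<open>A type-class normed space, with its points renamed along an injection.\<close>

definition renamed_space :: "('b::real_normed_vector \<Rightarrow> 'v) \<Rightarrow> 'v normed_structure" where
  "renamed_space h =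
     \<lparr>pts = range h,
      vadd = (\<lambda>u v. h (inv h u + inv h v)),
      vzero = h 0,
      vscale = (\<lambda>a u. h (a *\<^sub>R inv h u)),
      vnorm = (\<lambda>u. norm (inv h u))\<rparr>"

lemma banach_space_renamed:
  fixes h :: "'b::real_normed_vector \<Rightarrow> 'v"
  assumes "inj h" and compl: "complete (UNIV :: 'b set)"
  shows "banach_space (renamed_space h)"
proof -
  have d: "vdist (renamed_space h) (h a) (h b) = dist a b" for a b
    using assms by (simp add: vdist_def renamed_space_def dist_norm)
  have "\<exists>l\<in>range h. (\<lambda>n. vdist (renamed_space h) (\<sigma> n) l) \<longlonglongrightarrow> 0"
    if \<sigma>: "\<forall>n. \<sigma> n \<in> range h"
      "\<forall>\<epsilon>>0. \<exists>N. \<forall>m\<ge>N. \<forall>n\<ge>N. vdist (renamed_space h) (\<sigma> m) (\<sigma> n) < \<epsilon>" for \<sigma>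
  proof -
    define s where "s n = inv h (\<sigma> n)" for n
    have s: "\<sigma> n = h (s n)" for n
      using \<sigma>(1) by (simp add: s_def f_inv_into_f)
    have "Cauchy s"
      using \<sigma>(2) unfolding Cauchy_def s d by blast
    then obtain l where "s \<longlonglongrightarrow> l"
      using compl unfolding complete_def by blast
    then have "(\<lambda>n. vdist (renamed_space h) (\<sigma> n) (h l)) \<longlonglongrightarrow> 0"
      unfolding s d by (simp add: tendsto_dist_iff[symmetric])
    then show ?thesis by blast
  qed
  then show ?thesis
    using \<open>inj h\<close>
    by unfold_locales
      (auto simp: renamed_space_def algebra_simps inj_eq norm_triangle_ineq)
qed

text \<open>The space of bounded real sequences.\<close>

lemma complete_bounded_sequences: "complete (UNIV :: (nat \<Rightarrow>\<^sub>C real) set)"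
  unfolding complete_def
proof (intro allI impI, elim conjE)
  fix f :: "nat \<Rightarrow> nat \<Rightarrow>\<^sub>C real"
  assume "Cauchy f"
  then obtain g where "uniform_limit UNIV f g sequentially"
    using uniformly_convergent_eq_cauchy[of "\<lambda>_. True" f]
    unfolding Cauchy_def uniform_limit_sequentially_iff
    by (metis dist_fun_lt_imp_dist_val_lt)
  from uniform_limit_bcontfunE[OF this sequentially_bot]
  obtain l where "f \<longlonglongrightarrow> l" by metis
  then show "\<exists>l\<in>UNIV. f \<longlonglongrightarrow> l" by blast
qed

lemma openin_weak_topology:
  assumes "vfunctional F f" "open U"
  shows "openin (weak_topology F) {u \<in> pts F. f u \<in> U}"
  unfolding weak_topology_def
  by (rule topology_generated_by_Basis) (use assms in blast)

lemma topspace_weak_topology: "topspace (weak_topology F) = pts F"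
proof -
  have "vfunctional F (\<lambda>_. 0)"
    by (auto simp: vfunctional_def intro!: exI[of _ 0])
  from openin_subset[OF openin_weak_topology[OF this open_UNIV]] show ?thesis
    by (auto simp: weak_topology_def)
qed

text \<open>The Hahn-Banach theorem, for graphs of functionals.\<close>

lemma (in banach_space) hahn_banach:
  fixes G0 :: "('v \<times> real) set"
  assumes sub: "G0 \<subseteq> pts F \<times> UNIV" and ne: "(vzero F, 0) \<in> G0"
    and add: "\<And>u r v s. \<lbrakk>(u, r) \<in> G0; (v, s) \<in> G0\<rbrakk> \<Longrightarrow> (vadd F u v, r + s) \<in> G0"
    and scale: "\<And>u r a. (u, r) \<in> G0 \<Longrightarrow> (vscale F a u, a * r) \<in> G0"
    and bound: "\<And>u r. (u, r) \<in> G0 \<Longrightarrow> r \<le> vnorm F u"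
  obtains f where "vfunctional F f" "\<And>u. u \<in> pts F \<Longrightarrow> \<bar>f u\<bar> \<le> vnorm F u"
    "\<And>u r. (u, r) \<in> G0 \<Longrightarrow> f u = r"
proof -
  define ok where "ok G \<longleftrightarrow> G0 \<subseteq> G \<and> G \<subseteq> pts F \<times> UNIV \<and>
     (\<forall>u r v s. (u, r) \<in> G \<longrightarrow> (v, s) \<in> G \<longrightarrow> (vadd F u v, r + s) \<in> G) \<and>
     (\<forall>u r a. (u, r) \<in> G \<longrightarrow> (vscale F a u, a * r) \<in> G) \<and>
     (\<forall>u r. (u, r) \<in> G \<longrightarrow> r \<le> vnorm F u)" for G :: "('v \<times> real) set"
  have ok0: "ok G0"
    using assms by (auto simp: ok_def)
  have "\<exists>G\<in>Collect ok. \<forall>X\<in>Collect ok. G \<subseteq> X \<longrightarrow> X = G"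
  proof (rule subset_Zorn_nonempty)
    show "Collect ok \<noteq> {}" using ok0 by auto
    fix C assume "C \<noteq> {}" and ch: "subset.chain (Collect ok) C"
    then have okC: "\<And>G. G \<in> C \<Longrightarrow> ok G"
      by (auto simp: subset.chain_def)
    have up: "\<exists>G\<in>C. p \<in> G \<and> q \<in> G" if "p \<in> \<Union>C" "q \<in> \<Union>C" for p q
      using that ch unfolding subset.chain_def by blast
    have "ok (\<Union>C)"
      unfolding ok_def
    proof (intro conjI allI impI)
      show "G0 \<subseteq> \<Union>C" using okC \<open>C \<noteq> {}\<close> unfolding ok_def by blast
      show "\<Union>C \<subseteq> pts F \<times> UNIV" using okC unfolding ok_def by blast
      show "(vadd F u v, r + s) \<in> \<Union>C" if "(u, r) \<in> \<Union>C" "(v, s) \<in> \<Union>C" for u r v s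
        using up[OF that] okC unfolding ok_def by blast
      show "(vscale F a u, a * r) \<in> \<Union>C" if "(u, r) \<in> \<Union>C" for u r a
        using that okC unfolding ok_def by blast
      show "r \<le> vnorm F u" if "(u, r) \<in> \<Union>C" for u r
        using that okC unfolding ok_def by blast
    qed
    then show "\<Union>C \<in> Collect ok" by simp
  qed
  then obtain G where G: "ok G" and max: "\<And>X. ok X \<Longrightarrow> G \<subseteq> X \<Longrightarrow> X = G"
    by auto
  have Gp: "\<And>u r. (u, r) \<in> G \<Longrightarrow> u \<in> pts F"
    and Ga: "\<And>u r v s. \<lbrakk>(u, r) \<in> G; (v, s) \<in> G\<rbrakk> \<Longrightarrow> (vadd F u v, r + s) \<in> G"
    and Gs: "\<And>u r a. (u, r) \<in> G \<Longrightarrow> (vscale F a u, a * r) \<in> G"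
    and Gb: "\<And>u r. (u, r) \<in> G \<Longrightarrow> r \<le> vnorm F u"
    and G0G: "G0 \<subseteq> G"
    using G unfolding ok_def by blast+
  note closed = zero_closed add_closed scale_closed
  have lcomm: "vadd F u (vadd F v w) = vadd F v (vadd F u w)"
    if "u \<in> pts F" "v \<in> pts F" "w \<in> pts F" for u v w
    using that by (metis add_assoc add_comm)
  have dom: "\<exists>r. (v, r) \<in> G" if v: "v \<in> pts F" for v
  proof -
    have key: "r - vnorm F (vadd F u (vscale F (-1) v)) \<le> vnorm F (vadd F w v) - s"
      if "(u, r) \<in> G" "(w, s) \<in> G" for u r w s
    proof -
      note p = Gp[OF that(1)] Gp[OF that(2)] v
      have "vadd F (vscale F (-1) v) (vadd F w v) = w"
        using p by (metis add_comm add_neg add_zero lcomm scale_closed)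
      then have e: "vadd F (vadd F u (vscale F (-1) v)) (vadd F w v) = vadd F u w"
        using p by (simp add: add_assoc closed)
      have "r + s \<le> vnorm F (vadd F u w)"
        using Gb[OF Ga[OF that]] .
      also have "\<dots> \<le> vnorm F (vadd F u (vscale F (-1) v)) + vnorm F (vadd F w v)"
        using norm_triangle[of "vadd F u (vscale F (-1) v)" "vadd F w v"] p
        by (simp add: e closed)
      finally show ?thesis by simp
    qed
    define c where "c = (SUP (u, r)\<in>G. r - vnorm F (vadd F u (vscale F (-1) v)))"
    have z: "(vzero F, 0) \<in> G" using ne G0G by auto
    have bdd: "bdd_above ((\<lambda>(u, r). r - vnorm F (vadd F u (vscale F (-1) v))) ` G)"
      using key[OF _ z] by (auto intro!: bdd_aboveI)
    have lo: "r - vnorm F (vadd F u (vscale F (-1) v)) \<le> c" if "(u, r) \<in> G" for u r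
      unfolding c_def using cSUP_upper[OF that bdd] by simp
    have hi: "c \<le> vnorm F (vadd F w v) - s" if "(w, s) \<in> G" for w s
      unfolding c_def using z key[OF _ that] by (intro cSUP_least) auto
    define X where "X = {(vadd F u (vscale F t v), r + t * c) | u r t. (u, r) \<in> G}"
    have GX: "G \<subseteq> X"
    proof clarify
      fix u r assume ur: "(u, r) \<in> G"
      have "vscale F 0 v = vzero F"
        using v by (metis add_neg add_scale add.right_inverse scale_one)
      then have "(u, r) = (vadd F u (vscale F 0 v), r + 0 * c)"
        using Gp[OF ur] by (simp add: add_zero)
      then show "(u, r) \<in> X" using ur unfolding X_def by blast
    qed
    have "r + t * c \<le> vnorm F (vadd F u (vscale F t v))" if ur: "(u, r) \<in> G" for u r t
    proof -
      consider "t = 0" | "t > 0" | "t < 0" by linarith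
      then show ?thesis
      proof cases
        case 1
        have "vscale F 0 v = vzero F"
          using v by (metis add_neg add_scale add.right_inverse scale_one)
        then show ?thesis using 1 Gb[OF ur] Gp[OF ur] by (simp add: add_zero)
      next
        case 2
        have "vadd F u (vscale F t v) = vscale F t (vadd F (vscale F (1/t) u) v)"
          using 2 v Gp[OF ur] by (simp add: scale_add scale_scale closed scale_one)
        then have "vnorm F (vadd F u (vscale F t v)) = t * vnorm F (vadd F (vscale F (1/t) u) v)"
          using 2 v Gp[OF ur] by (simp add: norm_scale closed)
        moreover have "t * c \<le> t * (vnorm F (vadd F (vscale F (1/t) u) v) - 1/t * r)"
          using hi[OF Gs[OF ur, of "1/t"]] 2 by (intro mult_left_mono) auto
        ultimately show ?thesis using 2 by (simp add: right_diff_distrib)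
      next
        case 3
        define q where "q = - t"
        have q: "q > 0" "t = - q" using 3 by (auto simp: q_def)
        have "vadd F u (vscale F t v) =
            vscale F q (vadd F (vscale F (1/q) u) (vscale F (-1) v))"
          using q v Gp[OF ur] by (simp add: scale_add scale_scale closed scale_one)
        then have "vnorm F (vadd F u (vscale F t v)) =
            q * vnorm F (vadd F (vscale F (1/q) u) (vscale F (-1) v))"
          using q v Gp[OF ur] by (simp add: norm_scale closed)
        moreover have "q * (1/q * r - vnorm F (vadd F (vscale F (1/q) u) (vscale F (-1) v))) \<le> q * c"
          using lo[OF Gs[OF ur, of "1/q"]] q by (intro mult_left_mono) auto
        ultimately show ?thesis using q by (simp add: right_diff_distrib)
      qed
    qed
    then have bX: "r \<le> vnorm F u" if "(u, r) \<in> X" for u r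
      using that unfolding X_def by blast
    have "\<exists>u' r' t'. vadd F (vadd F u (vscale F t v)) (vadd F w (vscale F b v)) =
          vadd F u' (vscale F t' v) \<and> r + t * c + (s + b * c) = r' + t' * c \<and> (u', r') \<in> G"
      if "(u, r) \<in> G" "(w, s) \<in> G" for u r t w s b
    proof (intro exI conjI)
      note p = Gp[OF that(1)] Gp[OF that(2)] v
      show "vadd F (vadd F u (vscale F t v)) (vadd F w (vscale F b v)) =
          vadd F (vadd F u w) (vscale F (t + b) v)"
        using p by (simp add: add_scale add_assoc closed lcomm[of "vscale F t v" w])
      show "r + t * c + (s + b * c) = r + s + (t + b) * c" by (simp add: algebra_simps)
      show "(vadd F u w, r + s) \<in> G" using Ga that by blast
    qed
    then have aX: "(vadd F u w, r + s) \<in> X" if "(u, r) \<in> X" "(w, s) \<in> X" for u r w s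
      using that unfolding X_def by blast
    have "\<exists>u' r' t'. vscale F a (vadd F u (vscale F t v)) =
          vadd F u' (vscale F t' v) \<and> a * (r + t * c) = r' + t' * c \<and> (u', r') \<in> G"
      if "(u, r) \<in> G" for u r t a
    proof (intro exI conjI)
      show "vscale F a (vadd F u (vscale F t v)) =
          vadd F (vscale F a u) (vscale F (a * t) v)"
        using Gp[OF that] v by (simp add: scale_add scale_scale closed)
      show "a * (r + t * c) = a * r + a * t * c" by (simp add: algebra_simps)
      show "(vscale F a u, a * r) \<in> G" using Gs that by blast
    qed
    then have sX: "(vscale F a u, a * r) \<in> X" if "(u, r) \<in> X" for u r a
      using that unfolding X_def by blast
    have "X \<subseteq> pts F \<times> UNIV"
      using Gp v by (auto simp: X_def closed)
    then have "ok X"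
      unfolding ok_def using G0G GX bX aX sX by blast
    then have "X = G" using max GX by blast
    moreover have "(vadd F (vzero F) (vscale F 1 v), 0 + 1 * c) \<in> X"
      using z unfolding X_def by blast
    ultimately show ?thesis
      by auto (metis add_comm add_zero scale_one v zero_closed)
  qed
  have uniq: "r = s" if "(u, r) \<in> G" "(u, s) \<in> G" for u r s
  proof -
    have le: "r \<le> s" if "(u, r) \<in> G" "(u, s) \<in> G" for u r s
      using Gb[OF Ga[OF that(1) Gs[OF that(2), of "-1"]]] Gp[OF that(1)]
        norm_eq_zero[OF zero_closed] by (simp add: add_neg)
    show ?thesis using le that by (meson order.antisym)
  qed
  define f where "f u = (THE r. (u, r) \<in> G)" for u
  have fI: "f u = r" if "(u, r) \<in> G" for u r
    unfolding f_def using that uniq by blast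
  have fG: "(u, f u) \<in> G" if "u \<in> pts F" for u
    using dom[OF that] fI by blast
  have fs: "f (vscale F a u) = a * f u" if "u \<in> pts F" for a u
    using fI Gs fG that by blast
  have fb: "\<bar>f u\<bar> \<le> vnorm F u" if "u \<in> pts F" for u
    using Gb[OF fG[OF that]] Gb[OF fG[OF scale_closed[OF that, of "-1"]]] that
    by (simp add: fs norm_scale)
  have "f (vadd F u v) = f u + f v" if "u \<in> pts F" "v \<in> pts F" for u v
    using fI Ga fG that by blast
  then have "vfunctional F f"
    unfolding vfunctional_def using fs fb by (auto intro!: exI[of _ 1])
  then show thesis
    using that fb fI G0G by blast
qed

lemma (in banach_space) norming_functional:
  assumes v: "v \<in> pts F"
  obtains f where "vfunctional F f" "\<And>u. u \<in> pts F \<Longrightarrow> \<bar>f u\<bar> \<le> vnorm F u"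
    "f v = vnorm F v"
proof -
  have z: "vscale F 0 v = vzero F"
    using v by (metis add_neg add_scale add.right_inverse scale_one)
  let ?G = "range (\<lambda>t. (vscale F t v, t * vnorm F v))"
  obtain f where f: "vfunctional F f" "\<And>u. u \<in> pts F \<Longrightarrow> \<bar>f u\<bar> \<le> vnorm F u"
      "\<And>u r. (u, r) \<in> ?G \<Longrightarrow> f u = r"
  proof (rule hahn_banach[of ?G])
    show "?G \<subseteq> pts F \<times> UNIV" using v scale_closed by auto
    show "(vzero F, 0) \<in> ?G" using z by (auto intro!: image_eqI[of _ _ 0])
    show "(vadd F u w, r + s) \<in> ?G" if "(u, r) \<in> ?G" "(w, s) \<in> ?G" for u r w s
      using that v by (auto simp: add_scale[symmetric] distrib_right[symmetric])
    show "(vscale F a u, a * r) \<in> ?G" if "(u, r) \<in> ?G" for u r a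
      using that v by (auto simp: scale_scale)
    show "r \<le> vnorm F u" if "(u, r) \<in> ?G" for u r
      using that v norm_nonneg by (auto simp: norm_scale mult_right_mono)
  qed (rule that)
  have "f (vscale F 1 v) = 1 * vnorm F v" using f(3) by blast
  then show thesis using that f v by (simp add: scale_one)
qed

theorem weak_dunford_pettis_any_space:
  assumes wdp: "weak_dunford_pettis_property TYPE('a::banach_lattice)"
  shows "weak_dunford_pettis_into TYPE('a) TYPE('v)"
  unfolding weak_dunford_pettis_into_def
proof (intro allI impI, elim conjE)
  fix F :: "'v normed_structure" and T :: "'a \<Rightarrow> 'v" and x :: "nat \<Rightarrow> 'a"
  assume "banach_space F" and T: "weakly_compact_operator F T"
    and x: "weakly_null x" "pairwise_disjoint_seq x"
  interpret F: banach_space F by fact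
  have Tp: "T y \<in> pts F" for y
    using T by (simp add: weakly_compact_operator_def bounded_operator_def)
  show "(\<lambda>j. vnorm F (T (x j))) \<longlonglongrightarrow> 0"
  proof (cases "\<exists>e::'a. e \<noteq> 0")
    case False
    then have "T (x j) = T (0 *\<^sub>R 0)" for j by (metis scaleR_zero_left)
    also have "\<dots> = vscale F 0 (T 0)"
      using T unfolding weakly_compact_operator_def bounded_operator_def by blast
    finally show ?thesis by (simp add: F.norm_scale Tp)
  next
    case True
    then obtain e :: 'a where e: "e \<noteq> 0" ..
    define h :: "(nat \<Rightarrow>\<^sub>C real) \<Rightarrow> nat \<Rightarrow> 'a" where
      "h b n = apply_bcontfun b n *\<^sub>R e" for b n
    have h: "inj h"
      using e by (intro injI bcontfun_eqI) (auto simp: h_def fun_eq_iff)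
    let ?L = "renamed_space h"
    interpret L: banach_space ?L by (rule banach_space_renamed[OF h complete_bounded_sequences])
    have "\<exists>f. vfunctional F f \<and> (\<forall>u\<in>pts F. \<bar>f u\<bar> \<le> vnorm F u) \<and>
        f (T (x n)) = vnorm F (T (x n))" for n
      using F.norming_functional[OF Tp[of "x n"]] by metis
    then obtain f where f: "\<And>n. vfunctional F (f n)"
        and fb: "\<And>n u. u \<in> pts F \<Longrightarrow> \<bar>f n u\<bar> \<le> vnorm F u"
        and fx: "\<And>n. f n (T (x n)) = vnorm F (T (x n))"
      by metis
    have coord: "\<bar>apply_bcontfun b n\<bar> \<le> norm b" for b :: "nat \<Rightarrow>\<^sub>C real" and n
      using norm_bounded[of b n] by simp
    define S where "S u = Bcontfun (\<lambda>n. f n u)" for u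
    have S: "apply_bcontfun (S u) n = f n u" if "u \<in> pts F" for u n
      unfolding S_def using that fb[OF that]
      by (subst Bcontfun_inverse) (auto simp: bcontfun_def bounded_iff)
    have Sadd: "S (vadd F u v) = S u + S v" if "u \<in> pts F" "v \<in> pts F" for u v
      using that f by (intro bcontfun_eqI) (simp add: S F.add_closed vfunctional_def)
    have Sscale: "S (vscale F a u) = a *\<^sub>R S u" if "u \<in> pts F" for a u
      using that f by (intro bcontfun_eqI) (simp add: S F.scale_closed vfunctional_def)
    have Sb: "norm (S u) \<le> vnorm F u" if "u \<in> pts F" for u
      using that fb by (intro norm_bound) (simp add: S)
    define T' where "T' y = h (S (T y))" for y
    have "bounded_operator ?L T'"
      using T h Sb[OF Tp]
      unfolding weakly_compact_operator_def bounded_operator_def T'_def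
      by (auto simp: renamed_space_def Sadd Sscale) (meson order_trans)
    moreover have "compactin (weak_topology ?L) (weak_topology ?L closure_of (T' ` cball 0 1))"
    proof -
      let ?K = "weak_topology F closure_of (T ` cball 0 1)"
      have cont: "continuous_map (weak_topology F) (weak_topology ?L) (h \<circ> S)"
        unfolding weak_topology_def[of ?L]
      proof (rule continuous_on_generated_topo)
        fix W assume "W \<in> {{u \<in> pts ?L. g u \<in> U} | g U. vfunctional ?L g \<and> open U}"
        then obtain g U where W: "W = {u \<in> pts ?L. g u \<in> U}"
          and g: "vfunctional ?L g" and U: "open U" by blast
        obtain K where K: "\<And>b. \<bar>g (h b)\<bar> \<le> K * norm b"
          using g h by (auto simp: vfunctional_def renamed_space_def)
        have K': "\<bar>g (h (S u))\<bar> \<le> \<bar>K\<bar> * vnorm F u" if "u \<in> pts F" for u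
        proof -
          have "\<bar>g (h (S u))\<bar> \<le> \<bar>K\<bar> * norm (S u)"
            using K[of "S u"] by (smt (verit) mult_right_mono norm_ge_zero)
          also have "\<dots> \<le> \<bar>K\<bar> * vnorm F u"
            using Sb[OF that] by (intro mult_left_mono) auto
          finally show ?thesis .
        qed
        have "vfunctional F (\<lambda>u. g (h (S u)))"
          using g h K' unfolding vfunctional_def
          by (auto simp: renamed_space_def Sadd Sscale)
        moreover have "(h \<circ> S) -` W \<inter> topspace (weak_topology F) = {u \<in> pts F. g (h (S u)) \<in> U}"
          by (auto simp: topspace_weak_topology W renamed_space_def)
        ultimately show "openin (weak_topology F) ((h \<circ> S) -` W \<inter> topspace (weak_topology F))"
          using U by (simp add: openin_weak_topology)
      next
        show "(h \<circ> S) ` topspace (weak_topology F) \<subseteq>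
            \<Union> {{u \<in> pts ?L. g u \<in> U} | g U. vfunctional ?L g \<and> open U}"
          using topspace_weak_topology[of ?L] by (auto simp: weak_topology_def renamed_space_def)
      qed
      have haus: "Hausdorff_space (weak_topology ?L)"
        unfolding Hausdorff_space_def
      proof (intro allI impI)
        fix u v assume "u \<in> topspace (weak_topology ?L) \<and> v \<in> topspace (weak_topology ?L) \<and> u \<noteq> v"
        then obtain a b where ab: "u = h a" "v = h b" "a \<noteq> b"
          by (auto simp: topspace_weak_topology renamed_space_def)
        then obtain n where n: "apply_bcontfun a n \<noteq> apply_bcontfun b n"
          using bcontfun_eqI by blast
        let ?g = "\<lambda>w. apply_bcontfun (inv h w) n"
        have g: "vfunctional ?L ?g"
          using h coord[of _ n]
          by (auto simp: vfunctional_def renamed_space_def intro!: exI[of _ 1])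
        obtain U V where UV: "open U" "open V" "apply_bcontfun a n \<in> U" "apply_bcontfun b n \<in> V"
            "U \<inter> V = {}"
          using hausdorff[OF n] by blast
        show "\<exists>U V. openin (weak_topology ?L) U \<and> openin (weak_topology ?L) V \<and>
            u \<in> U \<and> v \<in> V \<and> disjnt U V"
        proof (intro exI conjI)
          show "openin (weak_topology ?L) {w \<in> pts ?L. ?g w \<in> U}"
            "openin (weak_topology ?L) {w \<in> pts ?L. ?g w \<in> V}"
            using g UV by (simp_all add: openin_weak_topology)
          show "u \<in> {w \<in> pts ?L. ?g w \<in> U}" "v \<in> {w \<in> pts ?L. ?g w \<in> V}"
            using ab UV h by (auto simp: renamed_space_def)
          show "disjnt {w \<in> pts ?L. ?g w \<in> U} {w \<in> pts ?L. ?g w \<in> V}"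
            using UV by (auto simp: disjnt_def)
        qed
      qed
      have "compactin (weak_topology F) ?K"
        using T by (simp add: weakly_compact_operator_def)
      then have SK: "compactin (weak_topology ?L) ((h \<circ> S) ` ?K)"
        by (rule image_compactin[OF _ cont])
      have "T ` cball 0 1 \<subseteq> ?K"
        using Tp by (intro closure_of_subset) (auto simp: topspace_weak_topology)
      then have "T' ` cball 0 1 \<subseteq> (h \<circ> S) ` ?K"
        by (auto simp: T'_def)
      then have "weak_topology ?L closure_of (T' ` cball 0 1) \<subseteq> (h \<circ> S) ` ?K"
        using compactin_imp_closedin[OF haus SK] by (rule closure_of_minimal)
      then show ?thesis
        by (rule closed_compactin[OF SK]) simp
    qed
    ultimately have "weakly_compact_operator ?L T'"
      by (simp add: weakly_compact_operator_def)
    then have "(\<lambda>j. vnorm ?L (T' (x j))) \<longlonglongrightarrow> 0"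
      using wdp x L.banach_space_axioms
      unfolding weak_dunford_pettis_property_def weak_dunford_pettis_into_def by blast
    moreover have "vnorm ?L (T' y) = norm (S (T y))" for y
      using h by (simp add: renamed_space_def T'_def)
    ultimately have lim: "(\<lambda>j. norm (S (T (x j)))) \<longlonglongrightarrow> 0"
      by simp
    have "vnorm F (T (x j)) \<le> norm (S (T (x j)))" for j
      using coord[of "S (T (x j))" j] by (simp add: S Tp fx)
    then show ?thesis
      using lim F.norm_nonneg[OF Tp]
      by (intro tendsto_sandwich[OF _ _ tendsto_const lim]) auto
  qed
qed

end

theory Submission
  imports Defs
begin

text \<open>
  Suppose that \<open>E\<close> has the positive Schur property. Every bounded functional on a Banach
  lattice is a difference of positive ones, so regular polynomials of degree one already test
  weak nullity, and the positive polynomial Schur property follows. If \<open>x\<close> is weakly null and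
  disjoint, then its absolute values are weakly null too (\<open>weakly_null_abs_disjoint\<close>: project
  a positive functional to the band generated by the positive parts of \<open>x\<close>). Hence \<open>x\<close> is norm
  null, and every bounded operator preserves this.

  The converse has two halves, which meet in the Schur property for disjoint sequences of
  positive vectors.

  The first half derives this property from the two hypotheses: on a disjoint weakly null
  sequence \<open>x\<close> in the unit ball all regular polynomials of positive degree tend to \<open>0\<close>
  (\<open>bounded_form_tendsto_0\<close>). By induction on the degree, the functionals
  \<open>f j = A (x j, \<dots>, x j, \<cdot>)\<close> form a weakly null sequence in the dual. Then
  \<open>v \<mapsto> (f n v)\<close> is a weakly compact operator into the space of null sequences
  (\<open>weakly_compact_evaluations\<close>), because its extension to the bidual still takes values
  there. The weak Dunford-Pettis property now gives \<open>f j (x j) \<longlonglongrightarrow> 0\<close>.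

  The second half shows that disjoint sequences suffice for the positive Schur property
  (\<open>positive_schur_if_disjoint_schur\<close>). From a sequence of positive vectors in the unit ball
  that no vector dominates up to \<open>\<epsilon>\<close>, disjoint minorants of norm at least \<open>\<epsilon> / 2\<close> can be
  extracted (\<open>disjoint_minorants\<close>). If the sequence is weakly null, so are the minorants, and
  this is impossible. Thus up to \<open>\<epsilon>\<close> a weakly null sequence of positive vectors lies in an
  order interval. As disjoint sequences in order intervals are weakly null, the norm is order
  continuous in the sense that monotone order bounded sequences converge
  (\<open>monotone_order_bounded_convergent\<close>). A subsequence on which a suitable strictly positive
  functional is summable then has tails whose suprema decrease to \<open>0\<close> in norm
  (\<open>order_bounded_weakly_null_subseq\<close>).
\<close>

section \<open>Lattice inequalities and the norm\<close>

lemma inf_add_le: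
  fixes d x y :: "'a::lattice_ab_group_add"
  assumes "0 \<le> d" "0 \<le> x" "0 \<le> y"
  shows "inf d (x + y) \<le> inf d x + inf d y"
proof -
  have "inf d (x + y) \<le> d + d" "inf d (x + y) \<le> d + y" "inf d (x + y) \<le> x + d"
    using assms by (meson add_increasing add_increasing2 inf.coboundedI1 order_refl)+
  then show ?thesis
    by (simp add: add_inf_distrib_left add_inf_distrib_right)
qed

lemma inf_sum_le:
  fixes d :: "'a::lattice_ab_group_add"
  assumes "finite I" "0 \<le> d" "\<And>i. i \<in> I \<Longrightarrow> 0 \<le> x i"
  shows "inf d (\<Sum>i\<in>I. x i) \<le> (\<Sum>i\<in>I. inf d (x i))"
  using assms(1,3)
proof (induction I rule: finite_induct)
  case empty
  then show ?case by simp
next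
  case (insert a I)
  have "inf d (x a + sum x I) \<le> inf d (x a) + inf d (sum x I)"
    using insert.prems assms(2) by (intro inf_add_le) (auto simp: sum_nonneg)
  also have "\<dots> \<le> inf d (x a) + (\<Sum>i\<in>I. inf d (x i))"
    using insert by simp
  finally show ?case using insert by simp
qed

lemma inf_pprt_pprt_minus: "inf (pprt a) (pprt (- a)) = (0::'a::lattice_ab_group_add)"
proof -
  have "inf (pprt a) (pprt (- a)) = inf (a + pprt (- a)) (0 + pprt (- a))"
    using prts[of a] by (simp add: pprt_neg) (metis add_diff_cancel_right')
  also have "\<dots> = inf a 0 + pprt (- a)"
    by (simp only: add_inf_distrib_right)
  also have "\<dots> = 0"
    unfolding pprt_neg by (simp only: nprt_def add.right_inverse)
  finally show ?thesis .
qed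

lemma inf_add_pprt_diff: "inf a b + pprt (a - b) = (a::'a::lattice_ab_group_add)"
proof -
  have "pprt (a - b) = sup a b - b"
    by (simp add: pprt_def add_sup_distrib_right[of a b "-b", simplified])
  then show ?thesis
    using add_eq_inf_sup[of a b] by (metis add.assoc add.commute add_right_cancel diff_add_cancel)
qed

lemma pprt_diff_le:
  fixes a b t :: "'a::lattice_ab_group_add"
  assumes "0 \<le> t"
  shows "pprt a \<le> pprt (a - t) + t"
  using assms unfolding pprt_def by (simp add: add_sup_distrib_right le_supI2)

lemma pprt_le: "a \<le> b \<Longrightarrow> 0 \<le> b \<Longrightarrow> pprt a \<le> (b::'a::lattice_ab_group_add)"
  by (simp add: pprt_def)

lemma inf_eq_0_mono:
  fixes a b :: "'a::lattice_ab_group_add"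
  assumes "inf c d = 0" "0 \<le> a" "a \<le> c" "0 \<le> b" "b \<le> d"
  shows "inf a b = 0"
  using assms by (metis inf_mono inf_greatest order.antisym)

lemma scaleR_inf:
  fixes x y :: "'a::banach_lattice"
  assumes "0 \<le> c"
  shows "c *\<^sub>R inf x y = inf (c *\<^sub>R x) (c *\<^sub>R y)"
proof (cases "c = 0")
  case False
  with assms have c: "0 < c" by simp
  have "inverse c *\<^sub>R inf (c *\<^sub>R x) (c *\<^sub>R y) \<le> inf x y"
  proof (rule le_infI)
    have "inverse c *\<^sub>R inf (c *\<^sub>R x) (c *\<^sub>R y) \<le> inverse c *\<^sub>R (c *\<^sub>R x)"
      using c by (intro scaleR_left_mono) auto
    then show "inverse c *\<^sub>R inf (c *\<^sub>R x) (c *\<^sub>R y) \<le> x" using c by simp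
    have "inverse c *\<^sub>R inf (c *\<^sub>R x) (c *\<^sub>R y) \<le> inverse c *\<^sub>R (c *\<^sub>R y)"
      using c by (intro scaleR_left_mono) auto
    then show "inverse c *\<^sub>R inf (c *\<^sub>R x) (c *\<^sub>R y) \<le> y" using c by simp
  qed
  then have "c *\<^sub>R (inverse c *\<^sub>R inf (c *\<^sub>R x) (c *\<^sub>R y)) \<le> c *\<^sub>R inf x y"
    using c by (intro scaleR_left_mono) auto
  then have "inf (c *\<^sub>R x) (c *\<^sub>R y) \<le> c *\<^sub>R inf x y" using c by simp
  moreover have "c *\<^sub>R inf x y \<le> inf (c *\<^sub>R x) (c *\<^sub>R y)"
    using c by (intro le_infI scaleR_left_mono) auto
  ultimately show ?thesis by (rule order.antisym[rotated])
qed simp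

lemma scaleR_pprt:
  fixes x :: "'a::banach_lattice"
  assumes "0 \<le> c"
  shows "c *\<^sub>R pprt x = pprt (c *\<^sub>R x)"
proof -
  have "c *\<^sub>R nprt x = nprt (c *\<^sub>R x)"
    using scaleR_inf[OF assms, of x 0] by (simp add: nprt_def)
  then show ?thesis
    using prts[of x] prts[of "c *\<^sub>R x"] by (metis add_right_cancel scaleR_right_distrib)
qed

lemma inf_scaleR_le:
  fixes x y :: "'a::banach_lattice"
  assumes "0 \<le> x" "0 \<le> y" "0 \<le> c" "0 \<le> d" "c \<le> m" "d \<le> m"
  shows "inf (c *\<^sub>R x) (d *\<^sub>R y) \<le> m *\<^sub>R inf x y"
proof -
  have "inf (c *\<^sub>R x) (d *\<^sub>R y) \<le> inf (m *\<^sub>R x) (m *\<^sub>R y)"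
    using assms by (intro inf_mono scaleR_right_mono) auto
  then show ?thesis using assms by (simp add: scaleR_inf)
qed

lemma norm_abs [simp]: "norm \<bar>x\<bar> = norm (x::'a::banach_lattice)"
  by (intro order.antisym norm_mono_abs) simp_all

lemma norm_mono:
  fixes x y :: "'a::banach_lattice"
  assumes "0 \<le> x" "x \<le> y"
  shows "norm x \<le> norm y"
  using assms by (intro norm_mono_abs) (simp add: order.trans[OF assms])

lemma norm_pprt_le: "norm (pprt x) \<le> norm (x::'a::banach_lattice)"
  by (metis abs_ge_self abs_ge_zero norm_abs norm_mono pprt_le zero_le_pprt)

text \<open>The positive cone is closed, because the positive part is controlled by the norm.\<close>

lemma tendsto_lower_bound_lattice:
  fixes a l :: "'a::banach_lattice"
  assumes "s \<longlonglongrightarrow> l" "\<And>n::nat. a \<le> s n"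
  shows "a \<le> l"
proof -
  have "norm (pprt (a - l)) \<le> norm (s n - l)" for n
    using norm_mono[of "pprt (a - l)" "pprt (s n - l)"] norm_pprt_le[of "s n - l"] assms(2)[of n]
    by (meson diff_right_mono order.trans pprt_mono zero_le_pprt)
  moreover have "(\<lambda>n. norm (s n - l)) \<longlonglongrightarrow> 0"
    using assms(1) by (simp add: LIM_zero tendsto_norm_zero)
  ultimately have "norm (pprt (a - l)) \<le> 0"
    by (intro tendsto_lowerbound[of "\<lambda>n. norm (s n - l)"]) auto
  then show ?thesis by (simp add: le_zero_iff_zero_pprt[symmetric])
qed

lemma tendsto_upper_bound_lattice:
  fixes a l :: "'a::banach_lattice"
  assumes "s \<longlonglongrightarrow> l" "\<And>n::nat. s n \<le> a"
  shows "l \<le> a"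
  using tendsto_lower_bound_lattice[of "\<lambda>n. - s n" "- l" "- a"] assms
  by (simp add: tendsto_minus)

lemma sum_disjoint_le:
  fixes y :: "nat \<Rightarrow> 'a::banach_lattice"
  assumes "\<And>i. 0 \<le> y i" "\<And>i. y i \<le> u" "\<And>i j. i \<noteq> j \<Longrightarrow> inf (y i) (y j) = 0"
  shows "(\<Sum>i<n. y i) \<le> u"
proof (induction n)
  case 0
  show ?case using assms(1,2) by (metis lessThan_0 order.trans sum.empty)
next
  case (Suc n)
  have "inf (y n) (\<Sum>i<n. y i) \<le> (\<Sum>i<n. inf (y n) (y i))"
    using assms by (intro inf_sum_le) auto
  also have "\<dots> = 0" using assms(3) by (intro sum.neutral) auto
  finally have "inf (y n) (\<Sum>i<n. y i) = 0"
    using assms(1) by (intro order.antisym) (auto simp: sum_nonneg)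
  \<comment> \<open>disjoint vectors have their supremum as sum\<close>
  then have "(\<Sum>i<Suc n. y i) = sup (y n) (\<Sum>i<n. y i)"
    using add_eq_inf_sup[of "y n" "\<Sum>i<n. y i"] by (simp add: add.commute)
  then show ?case using Suc assms(2) by simp
qed

section \<open>Positive functionals\<close>

definition positive_functional :: "('a::banach_lattice \<Rightarrow> real) \<Rightarrow> bool" where
  "positive_functional f \<longleftrightarrow> bounded_linear f \<and> (\<forall>x\<ge>0. 0 \<le> f x)"

lemma positive_functional_linear: "positive_functional f \<Longrightarrow> linear f"
  by (simp add: positive_functional_def bounded_linear.linear)

lemma positive_functional_mono: "positive_functional f \<Longrightarrow> x \<le> y \<Longrightarrow> f x \<le> f y"
  unfolding positive_functional_def
  by (metis bounded_linear.linear diff_ge_0_iff_ge linear_diff)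

lemma positive_functional_nonneg: "positive_functional f \<Longrightarrow> 0 \<le> x \<Longrightarrow> 0 \<le> f x"
  by (simp add: positive_functional_def)

text \<open>
  Every vector is a difference of two positive ones. Additivity on the cone makes
  \<open>p a - p b\<close> depend on \<open>a - b\<close> only.
\<close>

lemma positive_functional_extension:
  fixes p :: "'a::banach_lattice \<Rightarrow> real"
  assumes add: "\<And>x y. 0 \<le> x \<Longrightarrow> 0 \<le> y \<Longrightarrow> p (x + y) = p x + p y"
    and scale: "\<And>c x. 0 \<le> c \<Longrightarrow> 0 \<le> x \<Longrightarrow> p (c *\<^sub>R x) = c * p x"
    and nonneg: "\<And>x. 0 \<le> x \<Longrightarrow> 0 \<le> p x"
    and bound: "\<And>x. 0 \<le> x \<Longrightarrow> p x \<le> K * norm x"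
  obtains g where "positive_functional g" "\<And>x. 0 \<le> x \<Longrightarrow> g x = p x"
proof
  define g where "g x = p (pprt x) - p (pprt (- x))" for x
  have split: "g (a - b) = p a - p b" if "0 \<le> a" "0 \<le> b" for a b
  proof -
    have "a - b = pprt (a - b) - pprt (- (a - b))"
      using prts[of "a - b"] unfolding pprt_neg by simp
    then have "pprt (a - b) + b = pprt (- (a - b)) + a"
      by (metis add.commute diff_add_eq diff_add_cancel)
    then have "p (pprt (a - b)) + p b = p (pprt (- (a - b))) + p a"
      using that by (metis add zero_le_pprt)
    then show ?thesis by (simp add: g_def)
  qed
  have dec: "x = pprt x - pprt (- x)" for x :: 'a
    using prts[of x] by (simp add: pprt_neg)
  have p0: "p 0 = 0" using scale[of 0 0] by simp
  show gp: "g x = p x" if "0 \<le> x" for x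
    using split[of x 0] that p0 by simp
  have "g (x + y) = g x + g y" for x y
  proof -
    have "x + y = (pprt x + pprt y) - (pprt (- x) + pprt (- y))"
      using dec[of x] dec[of y] by (metis add_diff_add)
    then have "g (x + y) = p (pprt x + pprt y) - p (pprt (- x) + pprt (- y))"
      using split[of "pprt x + pprt y" "pprt (- x) + pprt (- y)"] by simp
    then show ?thesis by (simp add: add g_def)
  qed
  moreover have "g (c *\<^sub>R x) = c * g x" for c x
  proof (cases "0 \<le> c")
    case True
    then show ?thesis
      using scaleR_pprt[OF True, of x] scaleR_pprt[OF True, of "- x"] scale[OF True]
      by (simp add: g_def right_diff_distrib) (metis zero_le_pprt)
  next
    case False
    then have c: "0 \<le> - c" by simp
    have "c *\<^sub>R x = (- c) *\<^sub>R pprt (- x) - (- c) *\<^sub>R pprt x"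
      using dec[of x] by (metis minus_diff_eq scaleR_minus_left scaleR_minus_right scaleR_right_diff_distrib)
    then have "g (c *\<^sub>R x) = (- c) * p (pprt (- x)) - (- c) * p (pprt x)"
      using split[of "(- c) *\<^sub>R pprt (- x)" "(- c) *\<^sub>R pprt x"] c
      by (simp add: scale[OF c] scaleR_nonneg_nonneg del: scaleR_minus_left)
    then show ?thesis by (simp add: g_def algebra_simps)
  qed
  moreover have "norm (g x) \<le> norm x * K" for x
  proof -
    have "K * norm (pprt x) \<le> K * norm x" "K * norm (pprt (- x)) \<le> K * norm x" if "0 \<le> K"
      using that norm_pprt_le[of x] norm_pprt_le[of "- x"] by (simp_all add: mult_left_mono)
    moreover have "0 \<le> K * norm (pprt x)" "0 \<le> K * norm (pprt (- x))"
      using bound nonneg zero_le_pprt order.trans by metis+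
    ultimately have "K * norm (pprt x) \<le> K * norm x \<and> K * norm (pprt (- x)) \<le> K * norm x"
      using dec[of x] by (cases "0 \<le> K") (auto simp: zero_le_mult_iff)
    then show ?thesis
      using bound[of "pprt x"] bound[of "pprt (- x)"] nonneg[of "pprt x"] nonneg[of "pprt (- x)"]
      by (simp add: g_def abs_le_iff mult.commute)
  qed
  ultimately show "positive_functional g"
    using gp nonneg unfolding positive_functional_def
    by (auto intro!: bounded_linear_intro)
qed

text \<open>
  The positive part of a functional is the supremum of its values on the order interval
  below a vector. That this is additive is the Riesz decomposition property: a vector below
  \<open>x + y\<close> is the sum of one below \<open>x\<close> and one below \<open>y\<close>.
\<close>

lemma positive_majorant:
  fixes f :: "'a::banach_lattice \<Rightarrow> real"
  assumes f: "bounded_linear f" and K: "\<And>x. \<bar>f x\<bar> \<le> K * norm x"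
  obtains g where "positive_functional g" "\<And>x. 0 \<le> x \<Longrightarrow> f x \<le> g x"
    "\<And>x. 0 \<le> x \<Longrightarrow> g x \<le> K * norm x"
proof -
  interpret f: bounded_linear f by fact
  define p where "p x = (SUP y\<in>{0..x}. f y)" for x
  have ub: "f y \<le> K * norm x" if "0 \<le> y" "y \<le> x" for x y
  proof (cases "0 \<le> K")
    case True
    then show ?thesis
      using K[of y] norm_mono[OF that] mult_left_mono[of "norm y" "norm x" K] by linarith
  next
    case False
    then have "norm z = 0" for z :: 'a
      using K[of z] by (smt (verit) mult_neg_pos norm_ge_zero zero_less_norm_iff)
    then show ?thesis using f.zero by (metis mult_zero_right norm_eq_zero order_refl)
  qed
  have bdd: "bdd_above (f ` {0..x})" for x
    using ub by (auto intro!: bdd_aboveI2)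
  have up: "f y \<le> p x" if "0 \<le> y" "y \<le> x" for x y
    unfolding p_def using bdd that by (intro cSUP_upper) auto
  have least: "p x \<le> c" if "0 \<le> x" "\<And>y. 0 \<le> y \<Longrightarrow> y \<le> x \<Longrightarrow> f y \<le> c" for x c
    unfolding p_def using that by (intro cSUP_least) auto
  have "p (x + y) = p x + p y" if x: "0 \<le> x" and y: "0 \<le> y" for x y
  proof (rule order.antisym)
    show "p (x + y) \<le> p x + p y"
    proof (rule least)
      fix z assume z: "0 \<le> z" "z \<le> x + y"
      have "z - inf z x \<le> y"
      proof -
        have "z - inf z x = sup 0 (z - x)"
          by (simp add: add_sup_distrib_left)
        then show ?thesis using z y by (simp add: algebra_simps)
      qed
      then have "f (z - inf z x) \<le> p y" "f (inf z x) \<le> p x"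
        using z x by (auto intro!: up simp del: diff_inf_eq_sup)
      then show "f z \<le> p x + p y" by (simp add: f.diff del: diff_inf_eq_sup)
    qed (use x y in simp)
    have "f a + f b \<le> p (x + y)" if "0 \<le> a" "a \<le> x" "0 \<le> b" "b \<le> y" for a b
      using up[of "a + b" "x + y"] that by (simp add: f.add add_mono)
    then have "p x \<le> p (x + y) - f b" if "0 \<le> b" "b \<le> y" for b
      using least[OF x] that by (smt (verit))
    then have "p y \<le> p (x + y) - p x"
      using least[OF y] by (smt (verit))
    then show "p x + p y \<le> p (x + y)" by simp
  qed
  moreover have "p (c *\<^sub>R x) = c * p x" if c: "0 \<le> c" and x: "0 \<le> x" for c x
  proof -
    have le: "c * p x \<le> p (c *\<^sub>R x)" if c: "0 < c" and x: "0 \<le> x" for c x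
    proof -
      have "p x \<le> p (c *\<^sub>R x) / c"
        using up[of "c *\<^sub>R _" "c *\<^sub>R x"] c x
        by (intro least) (auto simp: f.scaleR field_simps scaleR_nonneg_nonneg scaleR_left_mono)
      then show ?thesis using c by (simp add: field_simps)
    qed
    have "p (0::'a) = 0"
      by (simp add: p_def f.zero)
    then show ?thesis
      using c le[of c x] le[of "inverse c" "c *\<^sub>R x"] x
      by (cases "c = 0") (auto simp: field_simps scaleR_nonneg_nonneg)
  qed
  moreover have "0 \<le> p x" if "0 \<le> x" for x
    using up[of 0 x] that by (simp add: f.zero)
  moreover have "p x \<le> K * norm x" if "0 \<le> x" for x
    using least[OF that] ub by blast
  ultimately obtain g where "positive_functional g" "\<And>x. 0 \<le> x \<Longrightarrow> g x = p x"
    using positive_functional_extension[of p K] by blast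
  then show thesis using that up \<open>\<And>x. 0 \<le> x \<Longrightarrow> p x \<le> K * norm x\<close> by auto
qed

lemma functional_difference_positive:
  fixes f :: "'a::banach_lattice \<Rightarrow> real"
  assumes f: "bounded_linear f"
  obtains g h where "positive_functional g" "positive_functional h" "\<And>x. f x = g x - h x"
proof -
  obtain K where "\<And>x. \<bar>f x\<bar> \<le> K * norm x"
    using bounded_linear.bounded[OF f] by (metis mult.commute real_norm_def)
  from positive_majorant[OF f this]
  obtain g where "positive_functional g" "\<And>x. 0 \<le> x \<Longrightarrow> f x \<le> g x" by metis
  then have "positive_functional (\<lambda>x. g x - f x)"
    using f by (simp add: positive_functional_def bounded_linear_sub)
  then show thesis
    using that[of g "\<lambda>x. g x - f x"] \<open>positive_functional g\<close> by simp
qed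

text \<open>
  A positive majorant of a norming functional from the Hahn-Banach theorem is still norming
  at \<open>v\<close>, since \<open>v\<close> is positive.
\<close>

lemma positive_norming_functional:
  fixes v :: "'a::banach_lattice"
  assumes "0 \<le> v"
  obtains f where "positive_functional f" "\<And>x. \<bar>f x\<bar> \<le> norm x" "norm v \<le> f v"
proof -
  interpret banach_space "renamed_space (id :: 'a \<Rightarrow> 'a)"
    by (rule banach_space_renamed) (auto simp: complete_UNIV)
  obtain f where f: "vfunctional (renamed_space id) f" "\<And>u::'a. \<bar>f u\<bar> \<le> norm u" "f v = norm v"
    using norming_functional[of v] by (auto simp: renamed_space_def)
  have "bounded_linear f"
    using f(1) by (intro bounded_linear_intro[of f 1])
      (use f(2) in \<open>auto simp: vfunctional_def renamed_space_def\<close>)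
  then obtain g where g: "positive_functional g" "\<And>x. 0 \<le> x \<Longrightarrow> f x \<le> g x"
      "\<And>x. 0 \<le> x \<Longrightarrow> g x \<le> 1 * norm x"
    using positive_majorant[of f 1] f(2) by auto
  have "\<bar>g x\<bar> \<le> norm x" for x
  proof -
    have "g x \<le> g \<bar>x\<bar>" and "g (- x) \<le> g \<bar>x\<bar>"
      using positive_functional_mono[OF g(1)] abs_ge_self abs_ge_minus_self by metis+
    then have "\<bar>g x\<bar> \<le> g \<bar>x\<bar>"
      using linear_neg[OF positive_functional_linear[OF g(1)], of x] by simp
    also have "\<dots> \<le> norm x" using g(3)[of "\<bar>x\<bar>"] by simp
    finally show ?thesis .
  qed
  then show thesis using that g f(3) assms by metis
qed

section \<open>Weakly null sequences\<close>

lemma weakly_nullI: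
  fixes x :: "nat \<Rightarrow> 'a::banach_lattice"
  assumes "\<And>f. positive_functional f \<Longrightarrow> (\<lambda>j. f (x j)) \<longlonglongrightarrow> 0"
  shows "weakly_null x"
  unfolding weakly_null_def
proof (intro allI impI)
  fix f :: "'a \<Rightarrow> real"
  assume "bounded_linear f"
  then obtain g h where "positive_functional g" "positive_functional h" "\<And>x. f x = g x - h x"
    by (rule functional_difference_positive) blast
  then show "(\<lambda>j. f (x j)) \<longlonglongrightarrow> 0"
    using tendsto_diff[OF assms assms, of g h] by simp
qed

lemma weakly_nullD: "weakly_null x \<Longrightarrow> positive_functional f \<Longrightarrow> (\<lambda>j. f (x j)) \<longlonglongrightarrow> 0"
  by (simp add: weakly_null_def positive_functional_def)

lemma weakly_null_dominated:
  fixes x y :: "nat \<Rightarrow> 'a::banach_lattice"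
  assumes x: "weakly_null x" and r: "strict_mono r"
    and y: "\<And>k. 0 \<le> y k" "\<And>k. y k \<le> x (r k)"
  shows "weakly_null y"
proof (rule weakly_nullI)
  fix f :: "'a \<Rightarrow> real" assume f: "positive_functional f"
  have "(\<lambda>k. f (x (r k))) \<longlonglongrightarrow> 0"
    using LIMSEQ_subseq_LIMSEQ[OF weakly_nullD[OF x f] r] by (simp add: o_def)
  then show "(\<lambda>k. f (y k)) \<longlonglongrightarrow> 0"
    by (rule tendsto_sandwich[OF _ _ tendsto_const, rotated 2])
      (simp_all add: positive_functional_nonneg[OF f y(1)] positive_functional_mono[OF f y(2)])
qed

text \<open>
  The partial sums of \<open>y\<close> stay below \<open>u\<close>, so the values of a positive functional along
  \<open>y\<close> are summable.
\<close>

lemma weakly_null_order_bounded_disjoint: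
  fixes y :: "nat \<Rightarrow> 'a::banach_lattice"
  assumes "\<And>i. 0 \<le> y i" "\<And>i. y i \<le> u" "\<And>i j. i \<noteq> j \<Longrightarrow> inf (y i) (y j) = 0"
  shows "weakly_null y"
proof (rule weakly_nullI)
  fix f :: "'a \<Rightarrow> real" assume f: "positive_functional f"
  have "(\<Sum>i<n. f (y i)) \<le> f u" for n
    using positive_functional_mono[OF f sum_disjoint_le[of y u n, OF assms]]
    by (simp add: linear_sum[OF positive_functional_linear[OF f]])
  then have "summable (\<lambda>i. f (y i))"
    using positive_functional_nonneg[OF f assms(1)] by (intro summableI_nonneg_bounded)
  then show "(\<lambda>i. f (y i)) \<longlonglongrightarrow> 0" by (rule summable_LIMSEQ_zero)
qed

text \<open>
  For disjoint \<open>x\<close> and a positive functional \<open>f\<close>, let \<open>g\<close> be the component of \<open>f\<close> on the band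
  generated by the positive parts of all \<open>x i\<close>, that is,
  \<open>g v = lim f (v \<and> k (pprt (x 0) + \<dots> + pprt (x (k - 1))))\<close>. It agrees with \<open>f\<close> on the
  positive parts and kills the negative ones, so \<open>f (pprt (x i)) = g (x i)\<close>.
\<close>

lemma positive_part_component:
  fixes x :: "nat \<Rightarrow> 'a::banach_lattice"
  assumes x: "pairwise_disjoint_seq x" and f: "positive_functional f"
  obtains g where "positive_functional g" "\<And>i. g (x i) = f (pprt (x i))"
proof -
  note lin = positive_functional_linear[OF f]
  note fmono = positive_functional_mono[OF f]
  define s where "s k = (\<Sum>i<k. real k *\<^sub>R pprt (x i))" for k
  have s_scale: "c *\<^sub>R s k \<le> s m" if "k \<le> m" "c * real k \<le> real m" for c k m
  proof -
    have "c *\<^sub>R s k = (\<Sum>i<k. (c * real k) *\<^sub>R pprt (x i))"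
      by (simp add: s_def scaleR_sum_right)
    also have "\<dots> \<le> (\<Sum>i<k. real m *\<^sub>R pprt (x i))"
      using that by (intro sum_mono scaleR_right_mono) auto
    also have "\<dots> \<le> s m"
      unfolding s_def using that by (intro sum_mono2) (auto intro: scaleR_nonneg_nonneg)
    finally show ?thesis .
  qed
  have s_nonneg: "0 \<le> s k" for k
    by (auto simp: s_def intro!: sum_nonneg scaleR_nonneg_nonneg)
  have s_mono: "s k \<le> s m" if "k \<le> m" for k m
    using s_scale[OF that, of 1] that by simp
  define q where "q k v = f (inf v (s k))" for k v
  define p where "p v = lim (\<lambda>k. q k v)" for v
  have lim: "(\<lambda>k. q k v) \<longlonglongrightarrow> p v" and q_le: "q k v \<le> p v" for v k
  proof -
    have inc: "incseq (\<lambda>k. q k v)"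
      using s_mono unfolding q_def incseq_def by (auto intro!: fmono inf_mono)
    have "q k v \<le> f v" for k
      unfolding q_def by (intro fmono) simp
    then have "bdd_above (range (\<lambda>k. q k v))" by (auto intro!: bdd_aboveI2)
    with inc have "convergent (\<lambda>k. q k v)"
      by (meson LIMSEQ_incseq_SUP convergentI)
    then show l: "(\<lambda>k. q k v) \<longlonglongrightarrow> p v" by (simp add: p_def convergent_LIMSEQ_iff)
    show "q k v \<le> p v" using incseq_le[OF inc l] .
  qed
  have p_le: "p v \<le> c" if "\<And>k. q k v \<le> c" for v c
    using that by (intro LIMSEQ_le_const2[OF lim]) blast
  have add: "p (v + w) = p v + p w" if v: "0 \<le> v" and w: "0 \<le> w" for v w
  proof (rule order.antisym)
    show "p (v + w) \<le> p v + p w"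
    proof (rule p_le)
      fix k
      have "q k (v + w) \<le> f (inf v (s k) + inf w (s k))"
        unfolding q_def using inf_add_le[OF s_nonneg v w] by (intro fmono) (simp add: inf_commute)
      also have "\<dots> = q k v + q k w" by (simp add: q_def linear_add[OF lin])
      finally show "q k (v + w) \<le> p v + p w" using q_le[of k v] q_le[of k w] by linarith
    qed
    have le: "q k v + q k w \<le> p (v + w)" for k
    proof -
      have "inf v (s k) + inf w (s k) \<le> inf (v + w) (s (2 * k))"
      proof (rule le_infI)
        have "inf v (s k) + inf w (s k) \<le> 2 *\<^sub>R s k"
          by (simp add: scaleR_2 add_mono)
        also have "\<dots> \<le> s (2 * k)" by (intro s_scale) auto
        finally show "inf v (s k) + inf w (s k) \<le> s (2 * k)" .
      qed (simp add: add_mono)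
      then have "q k v + q k w \<le> q (2 * k) (v + w)"
        unfolding q_def linear_add[OF lin, symmetric] by (rule fmono)
      then show ?thesis using q_le order.trans by blast
    qed
    show "p v + p w \<le> p (v + w)"
      using le by (intro LIMSEQ_le_const2[OF tendsto_add[OF lim lim]]) blast
  qed
  have scale_le: "p (c *\<^sub>R v) \<le> c * p v" if c: "0 < c" and v: "0 \<le> v" for c v
  proof (rule p_le)
    fix k
    obtain m where m: "real k / c \<le> real m" using real_arch_simple by blast
    have "inverse c *\<^sub>R s k \<le> s (k + m)"
      using m c by (intro s_scale) (auto simp: field_simps add_increasing)
    then have "c *\<^sub>R (inverse c *\<^sub>R s k) \<le> c *\<^sub>R s (k + m)"
      using c by (intro scaleR_left_mono) auto
    then have "inf (c *\<^sub>R v) (s k) \<le> c *\<^sub>R inf v (s (k + m))"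
      using c by (simp add: scaleR_inf le_infI2)
    then have "q k (c *\<^sub>R v) \<le> c * q (k + m) v"
      unfolding q_def using fmono linear_scale[OF lin] by fastforce
    also have "\<dots> \<le> c * p v" using q_le c by (simp add: mult_left_mono)
    finally show "q k (c *\<^sub>R v) \<le> c * p v" .
  qed
  have p_nonneg: "0 \<le> p v" if "0 \<le> v" for v
    using q_le[of 0 v] that by (simp add: q_def s_def inf_absorb2 linear_0[OF lin])
  have scale: "p (c *\<^sub>R v) = c * p v" if c: "0 \<le> c" and v: "0 \<le> v" for c v
  proof (cases "c = 0")
    case True
    then show ?thesis using p_le[of 0 0] p_nonneg[of 0] s_nonneg
      by (simp add: q_def inf_absorb1 linear_0[OF lin])
  next
    case False
    then have "p v \<le> inverse c * p (c *\<^sub>R v)"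
      using scale_le[of "inverse c" "c *\<^sub>R v"] c v by (simp add: scaleR_nonneg_nonneg)
    then show ?thesis using scale_le[of c v] c v False by (simp add: field_simps)
  qed
  obtain K where K: "\<And>v. \<bar>f v\<bar> \<le> K * norm v"
    using f unfolding positive_functional_def
    by (metis bounded_linear.bounded mult.commute real_norm_def)
  have "p v \<le> K * norm v" if "0 \<le> v" for v
  proof (rule p_le)
    fix k
    have "q k v \<le> f v" unfolding q_def by (intro fmono) simp
    then show "q k v \<le> K * norm v" using K[of v] by linarith
  qed
  with add scale p_nonneg obtain g where g: "positive_functional g" "\<And>v. 0 \<le> v \<Longrightarrow> g v = p v"
    using positive_functional_extension[of p K] by blast
  have "g (x i) = f (pprt (x i))" for i
  proof -
    have "p (pprt (x i)) = f (pprt (x i))"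
    proof (rule order.antisym)
      show "p (pprt (x i)) \<le> f (pprt (x i))"
        by (rule p_le) (simp add: q_def fmono)
      have "1 *\<^sub>R pprt (x i) \<le> real (Suc i) *\<^sub>R pprt (x i)"
        by (intro scaleR_right_mono) auto
      also have "\<dots> \<le> s (Suc i)"
        unfolding s_def
        using sum_mono2[of "{..<Suc i}" "{i}" "\<lambda>j. real (Suc i) *\<^sub>R pprt (x j)"]
        by (simp add: scaleR_nonneg_nonneg)
      finally have "q (Suc i) (pprt (x i)) = f (pprt (x i))"
        by (simp add: q_def inf_absorb1)
      then show "f (pprt (x i)) \<le> p (pprt (x i))" using q_le[of "Suc i" "pprt (x i)"] by simp
    qed
    moreover have "p (pprt (- x i)) = 0"
    proof -
      have "inf (pprt (- x i)) (pprt (x j)) = 0" for j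
      proof (cases "i = j")
        case True
        then show ?thesis using inf_pprt_pprt_minus[of "x i"] by (simp add: inf_commute)
      next
        case False
        then have "inf \<bar>x i\<bar> \<bar>x j\<bar> = 0" using x by (simp add: pairwise_disjoint_seq_def)
        then show ?thesis
          by (rule inf_eq_0_mono) (auto intro: pprt_le abs_ge_self abs_ge_minus_self)
      qed
      then have "inf (pprt (- x i)) (real k *\<^sub>R pprt (x j)) \<le> 0" for k j
        using inf_scaleR_le[of "pprt (- x i)" "pprt (x j)" 1 "real k" "max 1 (real k)"] by simp
      then have "(\<Sum>j<k. inf (pprt (- x i)) (real k *\<^sub>R pprt (x j))) \<le> 0" for k
        by (intro sum_nonpos)
      moreover have "inf (pprt (- x i)) (s k) \<le> (\<Sum>j<k. inf (pprt (- x i)) (real k *\<^sub>R pprt (x j)))" for k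
        unfolding s_def by (intro inf_sum_le) (auto intro: scaleR_nonneg_nonneg)
      ultimately have "inf (pprt (- x i)) (s k) \<le> 0" for k
        using order.trans by blast
      then have "q k (pprt (- x i)) \<le> 0" for k
        unfolding q_def using fmono[of "inf (pprt (- x i)) (s k)" 0] linear_0[OF lin] by simp
      then show ?thesis using p_le[of "pprt (- x i)" 0] p_nonneg[of "pprt (- x i)"] by simp
    qed
    moreover have "g (x i) = g (pprt (x i)) - g (pprt (- x i))"
      using prts[of "x i"] linear_diff[OF positive_functional_linear[OF g(1)]]
      by (metis add_uminus_conv_diff minus_minus pprt_neg)
    ultimately show ?thesis by (simp add: g(2))
  qed
  with g(1) show thesis by (rule that)
qed

lemma weakly_null_abs_disjoint:
  fixes x :: "nat \<Rightarrow> 'a::banach_lattice"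
  assumes x: "pairwise_disjoint_seq x" and null: "weakly_null x"
  shows "weakly_null (\<lambda>i. \<bar>x i\<bar>)"
proof (rule weakly_nullI)
  fix f :: "'a \<Rightarrow> real" assume f: "positive_functional f"
  have part: "(\<lambda>i. f (pprt (y i))) \<longlonglongrightarrow> 0"
    if y: "pairwise_disjoint_seq y" "weakly_null y" for y :: "nat \<Rightarrow> 'a"
  proof -
    obtain g where "positive_functional g" "\<And>i. g (y i) = f (pprt (y i))"
      using positive_part_component[OF y(1) f] by blast
    then show ?thesis using weakly_nullD[OF y(2), of g] by simp
  qed
  have "pairwise_disjoint_seq (\<lambda>i. - x i)" "weakly_null (\<lambda>i. - x i)"
    using x null unfolding pairwise_disjoint_seq_def weakly_null_def
    by (auto simp: bounded_linear.linear linear_neg intro: tendsto_minus_cancel)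
  then have "(\<lambda>i. f (pprt (x i)) + f (pprt (- x i))) \<longlonglongrightarrow> 0 + 0"
    by (intro tendsto_add part x null)
  moreover have "f \<bar>x i\<bar> = f (pprt (x i)) + f (pprt (- x i))" for i
    unfolding abs_prts pprt_neg
    by (simp flip: linear_add[OF positive_functional_linear[OF f]])
  ultimately show "(\<lambda>i. f \<bar>x i\<bar>) \<longlonglongrightarrow> 0" by simp
qed

section \<open>Extracting disjoint sequences\<close>

text \<open>The sum of the \<open>a k / 2 ^ k\<close> converges absolutely and dominates each of its terms.\<close>

lemma geometric_majorant:
  fixes a :: "nat \<Rightarrow> 'a::banach_lattice"
  assumes a: "\<And>k. 0 \<le> a k" "\<And>k. norm (a k) \<le> M"
  obtains s where "0 \<le> s" "norm s \<le> 2 * M" "\<And>k. (1/2) ^ k *\<^sub>R a k \<le> s"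
proof
  define t where "t k = (1/2) ^ k *\<^sub>R a k" for k :: nat
  have t_norm: "norm (t k) \<le> M * (1/2) ^ k" for k
    using mult_left_mono[OF a(2)[of k], of "(1/2) ^ k"] by (simp add: t_def mult.commute)
  have geo: "summable (\<lambda>k. M * (1/2::real) ^ k)" "(\<Sum>k. M * (1/2::real) ^ k) = 2 * M"
    using suminf_geometric[of "1/2::real"] by (auto intro!: summable_mult simp: suminf_mult)
  have t_norm_summable: "summable (\<lambda>k. norm (t k))"
    using t_norm by (intro summable_comparison_test'[OF geo(1), where N=0]) simp
  then have t_sums: "(\<lambda>n. \<Sum>k<n. t k) \<longlonglongrightarrow> suminf t"
    using summable_norm_cancel summable_LIMSEQ by blast
  have t_nonneg: "0 \<le> t k" for k using a(1) by (simp add: t_def scaleR_nonneg_nonneg)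
  have le: "t k \<le> suminf t" for k
  proof (rule tendsto_lower_bound_lattice[OF LIMSEQ_ignore_initial_segment[OF t_sums, of "Suc k"]])
    fix n
    show "t k \<le> (\<Sum>i<n + Suc k. t i)"
      using sum_mono2[of "{..<n + Suc k}" "{k}" t] t_nonneg by simp
  qed
  show "0 \<le> suminf t" using le[of 0] t_nonneg[of 0] by (rule order.trans[rotated])
  have "norm (suminf t) \<le> (\<Sum>k. norm (t k))" by (rule summable_norm[OF t_norm_summable])
  also have "\<dots> \<le> 2 * M"
    using suminf_le[OF _ t_norm_summable geo(1)] t_norm geo(2) by simp
  finally show "norm (suminf t) \<le> 2 * M" .
  show "(1/2) ^ k *\<^sub>R a k \<le> suminf t" for k using le[of k] by (simp add: t_def)
qed

text \<open>
  Thin out the sequence so that the positive excess of each chosen vector \<open>a k\<close> over a huge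
  multiple of the earlier ones has norm at least \<open>\<epsilon>\<close>. Subtract from \<open>a k\<close> this multiple and
  also a small multiple of all later ones, and let \<open>y k\<close> be the positive part. For \<open>j < k\<close>
  this puts \<open>y j\<close> and \<open>y k\<close> below the positive parts of \<open>a j - (1 / c) a k\<close> and
  \<open>a k - c a j\<close> for some \<open>c \<ge> 1\<close>. These two vectors are negative multiples of each other, so
  that their positive parts are disjoint.
\<close>

lemma disjoint_minorants:
  fixes x :: "nat \<Rightarrow> 'a::banach_lattice"
  assumes x: "\<And>n. 0 \<le> x n" and M: "\<And>n. norm (x n) \<le> M" "0 < M" and \<epsilon>: "0 < \<epsilon>"
    and big: "\<And>C N. 0 \<le> C \<Longrightarrow> \<exists>n. \<epsilon> \<le> norm (pprt (x n - C *\<^sub>R (\<Sum>i<N. x i)))"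
  obtains r :: "nat \<Rightarrow> nat" and y :: "nat \<Rightarrow> 'a" where "strict_mono r"
    "\<And>k. 0 \<le> y k" "\<And>k. y k \<le> x (r k)"
    "\<And>j k. j \<noteq> k \<Longrightarrow> inf (y j) (y k) = 0" "\<And>k. \<epsilon> / 2 \<le> norm (y k)"
proof -
  \<comment> \<open>Subtracting \<open>\<delta> *\<^sub>R \<tau>\<close>, with \<open>\<tau>\<close> of norm at most \<open>2 * M\<close>, costs at most \<open>\<epsilon> / 2\<close>.\<close>
  define \<delta> where "\<delta> = min 1 (\<epsilon> / (4 * M))"
  have \<delta>: "0 < \<delta>" "\<delta> \<le> 1" "\<delta> * (2 * M) \<le> \<epsilon> / 2"
    using \<epsilon> M(2) by (auto simp: \<delta>_def min_def field_simps)
  \<comment> \<open>The vector \<open>\<delta> *\<^sub>R \<tau>\<close> will dominate \<open>(\<delta> / 2 ^ k) *\<^sub>R a k\<close>, that is, \<open>a k /\<^sub>R C k\<close>.\<close>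
  define C where "C k = 2 ^ k / \<delta>" for k :: nat
  have C: "1 \<le> C k" for k
  proof -
    have "\<delta> \<le> 2 ^ k" using \<delta>(2) one_le_power[of "2::real" k] by linarith
    then show ?thesis using \<delta>(1) by (simp add: C_def field_simps)
  qed
  define S where "S m = (\<Sum>i<Suc m. x i)" for m
  have S_nonneg: "0 \<le> S m" for m unfolding S_def using x by (intro sum_nonneg)
  have le_S: "x i \<le> S m" if "i \<le> m" for i m
    using that x sum_mono2[of "{..<Suc m}" "{i}" x] by (simp add: S_def del: sum.lessThan_Suc)
  have "\<exists>r. \<forall>k. True \<and> r k < r (Suc k) \<and> \<epsilon> \<le> norm (pprt (x (r (Suc k)) - C k *\<^sub>R S (r k)))"
  proof (rule dependent_nat_choice)
    fix m k :: nat
    obtain n where n: "\<epsilon> \<le> norm (pprt (x n - C k *\<^sub>R S m))"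
      using big[of "C k" "Suc m"] C[of k] by (auto simp: S_def)
    have "m < n"
    proof (rule ccontr)
      assume "\<not> m < n"
      then have "x n \<le> 1 *\<^sub>R S m" using le_S by simp
      also have "\<dots> \<le> C k *\<^sub>R S m" using C S_nonneg by (intro scaleR_right_mono)
      finally have "pprt (x n - C k *\<^sub>R S m) = 0" by (intro pprt_eq_0) simp
      then show False using n \<epsilon> by simp
    qed
    then show "\<exists>n. True \<and> m < n \<and> \<epsilon> \<le> norm (pprt (x n - C k *\<^sub>R S m))" using n by blast
  qed simp
  then obtain r where r: "\<And>k. r k < r (Suc k)"
      and rb: "\<And>k. \<epsilon> \<le> norm (pprt (x (r (Suc k)) - C k *\<^sub>R S (r k)))"
    by blast
  have mono: "strict_mono r" using r by (rule strict_mono_Suc_iff[THEN iffD2, rule_format])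
  define a where "a k = x (r (Suc k))" for k
  have a: "0 \<le> a k" "norm (a k) \<le> M" for k by (simp_all add: a_def x M)
  obtain \<tau> where tau: "0 \<le> \<tau>" "norm \<tau> \<le> 2 * M" "\<And>k. (1/2) ^ k *\<^sub>R a k \<le> \<tau>"
    using geometric_majorant[of a, OF a] by blast
  have "\<delta> * norm \<tau> \<le> \<epsilon> / 2"
    using \<delta> tau(2) mult_left_mono[of "norm \<tau>" "2 * M" \<delta>] by linarith
  then have tau_norm: "norm (\<delta> *\<^sub>R \<tau>) \<le> \<epsilon> / 2" using \<delta> by simp
  define y where "y k = pprt (a k - C k *\<^sub>R S (r k) - \<delta> *\<^sub>R \<tau>)" for k
  have CS_nonneg: "0 \<le> C k *\<^sub>R S m" for k m
    using C[of k] S_nonneg by (intro scaleR_nonneg_nonneg) auto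
  have dtau_nonneg: "0 \<le> \<delta> *\<^sub>R \<tau>" using \<delta> tau(1) by (simp add: scaleR_nonneg_nonneg)
  have disj: "inf (y j) (y k) = 0" if jk: "j < k" for j k
  proof -
    have "C k *\<^sub>R a j \<le> C k *\<^sub>R S (r k)"
      unfolding a_def using jk mono C[of k]
      by (intro scaleR_left_mono le_S) (auto simp: strict_mono_less_eq Suc_leI)
    then have yk: "y k \<le> pprt (a k - C k *\<^sub>R a j)"
      unfolding y_def using dtau_nonneg by (intro pprt_mono) (simp add: algebra_simps add_increasing)
    have "inverse (C k) *\<^sub>R a k \<le> \<delta> *\<^sub>R \<tau>"
      using \<delta> scaleR_left_mono[OF tau(3)[of k], of \<delta>]
      by (simp add: C_def power_one_over divide_simps)
    then have yj: "y j \<le> pprt (a j - inverse (C k) *\<^sub>R a k)"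
      unfolding y_def using CS_nonneg[of j "r j"] by (intro pprt_mono) (simp add: algebra_simps add_increasing2)
    let ?b = "a k - C k *\<^sub>R a j"
    have Cpos: "0 < C k" using C[of k] by linarith
    have "a j - inverse (C k) *\<^sub>R a k = inverse (C k) *\<^sub>R (- ?b)"
      using Cpos by (simp add: scaleR_right_diff_distrib)
    then have "pprt (a j - inverse (C k) *\<^sub>R a k) = inverse (C k) *\<^sub>R pprt (- ?b)"
      using scaleR_pprt[of "inverse (C k)" "- ?b"] Cpos by simp
    moreover have "inf (inverse (C k) *\<^sub>R pprt (- ?b)) (1 *\<^sub>R pprt ?b) \<le> 1 *\<^sub>R inf (pprt (- ?b)) (pprt ?b)"
      using Cpos C[of k] by (intro inf_scaleR_le) (auto simp: inverse_le_1_iff)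
    moreover have "1 *\<^sub>R inf (pprt (- ?b)) (pprt ?b) = 0"
      using inf_pprt_pprt_minus[of ?b] by (simp add: inf_commute)
    ultimately have "inf (pprt (a j - inverse (C k) *\<^sub>R a k)) (pprt ?b) \<le> 0"
      by (metis scaleR_one)
    then have "inf (pprt (a j - inverse (C k) *\<^sub>R a k)) (pprt ?b) = 0"
      by (intro order.antisym) auto
    then show ?thesis
      by (rule inf_eq_0_mono) (use yj yk in \<open>simp_all add: y_def\<close>)
  qed
  show thesis
  proof (rule that)
    show "strict_mono (\<lambda>k. r (Suc k))" using mono by (simp add: strict_mono_def)
    show "0 \<le> y k" for k by (simp add: y_def)
    show "y k \<le> x (r (Suc k))" for k
      unfolding y_def a_def[symmetric] using a CS_nonneg[of k "r k"] dtau_nonneg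
      by (intro pprt_le) (auto simp: diff_le_eq add_increasing2)
    show "inf (y j) (y k) = 0" if "j \<noteq> k" for j k
      using that disj[of j k] disj[of k j] by (cases "j < k") (auto simp: inf_commute)
    show "\<epsilon> / 2 \<le> norm (y k)" for k
    proof -
      let ?b = "a k - C k *\<^sub>R S (r k)"
      have "norm (pprt ?b) \<le> norm (y k + \<delta> *\<^sub>R \<tau>)"
        unfolding y_def using pprt_diff_le[OF dtau_nonneg] by (intro norm_mono) auto
      then show ?thesis
        using rb[of k] tau_norm norm_triangle_ineq[of "y k" "\<delta> *\<^sub>R \<tau>"]
        by (simp add: a_def)
    qed
  qed
qed

section \<open>The Schur property for disjoint sequences\<close>

definition disjoint_schur_property :: "'a::banach_lattice itself \<Rightarrow> bool" where
  "disjoint_schur_property _ \<longleftrightarrow>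
     (\<forall>y :: nat \<Rightarrow> 'a. (\<forall>j. 0 \<le> y j) \<and> pairwise_disjoint_seq y \<and> weakly_null y \<longrightarrow> y \<longlonglongrightarrow> 0)"

lemma disjoint_schurD:
  fixes y :: "nat \<Rightarrow> 'a::banach_lattice"
  assumes "disjoint_schur_property TYPE('a)" "weakly_null y" "\<And>j. 0 \<le> y j"
    "\<And>i j. i \<noteq> j \<Longrightarrow> inf (y i) (y j) = 0"
  shows "y \<longlonglongrightarrow> 0"
  using assms unfolding disjoint_schur_property_def pairwise_disjoint_seq_def
  by simp

lemma not_tendsto_0_if_norm_ge:
  fixes y :: "nat \<Rightarrow> 'a::real_normed_vector"
  assumes "0 < e" "\<And>k. e \<le> norm (y k)"
  shows "\<not> y \<longlonglongrightarrow> 0"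
proof
  assume "y \<longlonglongrightarrow> 0"
  then have "(\<lambda>k. norm (y k)) \<longlonglongrightarrow> 0" by (rule tendsto_norm_zero)
  then have "e \<le> 0" using assms(2) by (intro LIMSEQ_le_const) auto
  with assms(1) show False by simp
qed

text \<open>
  Otherwise disjoint minorants of norm at least \<open>\<epsilon> / 2\<close> exist. They are weakly null,
  being dominated by a subsequence of \<open>x\<close>.
\<close>

lemma weakly_null_almost_order_bounded:
  fixes x :: "nat \<Rightarrow> 'a::banach_lattice"
  assumes H: "disjoint_schur_property TYPE('a)"
    and x: "weakly_null x" "\<And>n. 0 \<le> x n" "\<And>n. norm (x n) \<le> 1" and \<epsilon>: "0 < \<epsilon>"
  shows "\<exists>v\<ge>0. \<forall>n. norm (pprt (x n - v)) < \<epsilon>"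
proof (rule ccontr)
  assume no: "\<not> ?thesis"
  have "\<exists>n. \<epsilon> \<le> norm (pprt (x n - C *\<^sub>R (\<Sum>i<N. x i)))" if "0 \<le> C" for C N
  proof -
    have "0 \<le> C *\<^sub>R (\<Sum>i<N. x i)"
      using that x(2) by (intro scaleR_nonneg_nonneg sum_nonneg)
    then show ?thesis using no by (meson not_le)
  qed
  from disjoint_minorants[of x, OF x(2,3) zero_less_one \<epsilon> this]
  obtain r y where r: "strict_mono r" and y: "\<And>k::nat. 0 \<le> y k" "\<And>k. y k \<le> x (r k)"
    "\<And>j k. j \<noteq> k \<Longrightarrow> inf (y j) (y k) = 0" "\<And>k. \<epsilon> / 2 \<le> norm (y k)" by blast
  have "y \<longlonglongrightarrow> 0"
    using H weakly_null_dominated[OF x(1) r y(1,2)] y(1,3) by (rule disjoint_schurD)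
  then show False using not_tendsto_0_if_norm_ge[of "\<epsilon> / 2" y] y(4) \<epsilon> by simp
qed

text \<open>
  Induction on the overlap \<open>k\<close>. Either disjoint minorants can be extracted, or all \<open>p n\<close>
  essentially lie below a multiple of finitely many of them. In the latter case infinitely
  many \<open>p n\<close> have a large infimum with the same \<open>p i\<close>, and these infima overlap less.
\<close>

lemma no_bounded_overlap:
  fixes p :: "nat \<Rightarrow> 'a::banach_lattice"
  assumes H: "disjoint_schur_property TYPE('a)"
    and p: "\<And>n. 0 \<le> p n" "\<And>n. p n \<le> u" "\<And>n. \<delta> \<le> norm (p n)" "0 < \<delta>"
    and overlap: "\<And>F d. finite F \<Longrightarrow> card F = k \<Longrightarrow> 0 \<le> d \<Longrightarrow> (\<And>i. i \<in> F \<Longrightarrow> d \<le> p i) \<Longrightarrow> d = 0"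
  shows False
  using p overlap
proof (induction k arbitrary: p \<delta>)
  case 0
  have "p 0 = 0" using "0.prems"(5)[of "{}" "p 0"] "0.prems"(1) by simp
  then show False using "0.prems"(3)[of 0] "0.prems"(4) by simp
next
  case (Suc k)
  note p = Suc.prems(1-4)
  \<comment> \<open>For \<open>k = 0\<close> the induction hypothesis is of no use: the empty family has all vectors as
    common minorants. But then single vectors have no overlap, so they vanish.\<close>
  have "k \<noteq> 0"
  proof
    assume "k = 0"
    then have "p 0 = 0" using Suc.prems(5)[of "{0}" "p 0"] p(1) by simp
    then show False using p(3)[of 0] p(4) by simp
  qed
  have bound: "norm (p n) \<le> max 1 (norm u)" for n
    using norm_mono[OF p(1,2)[of n]] by simp
  show False
  proof (cases "\<forall>C N. 0 \<le> C \<longrightarrow> (\<exists>n. \<delta> / 2 \<le> norm (pprt (p n - C *\<^sub>R (\<Sum>i<N. p i))))")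
    case True
    have pos: "0 < max 1 (norm u)" "0 < \<delta> / 2" using p(4) by auto
    obtain r y where y: "strict_mono r" "\<And>k::nat. 0 \<le> y k" "\<And>k. y k \<le> p (r k)"
        "\<And>j k. j \<noteq> k \<Longrightarrow> inf (y j) (y k) = 0" "\<And>k. \<delta> / 2 / 2 \<le> norm (y k)"
      using disjoint_minorants[of p, OF p(1) bound pos] True by blast
    have "y k \<le> u" for k using y(3) p(2) order.trans by blast
    then have "weakly_null y"
      using y(2,4) by (intro weakly_null_order_bounded_disjoint)
    then have "y \<longlonglongrightarrow> 0"
      using y(2,4) by (rule disjoint_schurD[OF H])
    then show False using not_tendsto_0_if_norm_ge[of "\<delta> / 2 / 2" y] y(5) p(4) by simp
  next
    case False
    then obtain C N where C: "0 \<le> C"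
      and lt: "\<And>n. norm (pprt (p n - C *\<^sub>R (\<Sum>i<N. p i))) < \<delta> / 2"
      by (meson not_le)
    define C' where "C' = max 1 C"
    have C': "0 < C'" "1 \<le> C'" "C \<le> C'" by (auto simp: C'_def)
    have sum_ge: "\<delta> / 2 \<le> C' * (\<Sum>i<N. norm (inf (p n) (p i)))" for n
    proof -
      let ?v = "C *\<^sub>R (\<Sum>i<N. p i)"
      have "norm (p n) \<le> norm (inf (p n) ?v) + norm (pprt (p n - ?v))"
        using norm_triangle_ineq[of "inf (p n) ?v" "pprt (p n - ?v)"]
        by (simp add: inf_add_pprt_diff)
      then have "\<delta> / 2 \<le> norm (inf (p n) ?v)" using lt[of n] p(3)[of n] by linarith
      also have "inf (p n) ?v \<le> (\<Sum>i<N. C' *\<^sub>R inf (p n) (p i))"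
      proof -
        have "inf (p n) ?v \<le> (\<Sum>i<N. inf (p n) (C *\<^sub>R p i))"
          unfolding scaleR_sum_right using C p(1) by (intro inf_sum_le) (auto intro: scaleR_nonneg_nonneg)
        also have "\<dots> \<le> (\<Sum>i<N. C' *\<^sub>R inf (p n) (p i))"
          using inf_scaleR_le[of "p n" _ 1 C C'] C C' p(1) by (intro sum_mono) simp
        finally show ?thesis .
      qed
      then have "norm (inf (p n) ?v) \<le> norm (\<Sum>i<N. C' *\<^sub>R inf (p n) (p i))"
        using p(1) C by (intro norm_mono) (auto intro!: scaleR_nonneg_nonneg sum_nonneg)
      also have "\<dots> \<le> (\<Sum>i<N. norm (C' *\<^sub>R inf (p n) (p i)))" by (rule norm_sum)
      also have "\<dots> = C' * (\<Sum>i<N. norm (inf (p n) (p i)))"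
        using C' by (simp add: sum_distrib_left)
      finally show ?thesis .
    qed
    have N: "0 < N" using sum_ge[of 0] p(4) by (cases N) auto
    define \<delta>' where "\<delta>' = \<delta> / (2 * C' * N)"
    have "\<exists>i<N. \<delta>' \<le> norm (inf (p n) (p i))" for n
    proof (rule ccontr)
      assume "\<not> ?thesis"
      then have "(\<Sum>i<N. norm (inf (p n) (p i))) < (\<Sum>i<N. \<delta>')"
        using N by (intro sum_strict_mono) (auto simp: not_le)
      then have "C' * (\<Sum>i<N. norm (inf (p n) (p i))) < C' * (N * \<delta>')" using C' by simp
      then show False using sum_ge[of n] C' N by (simp add: \<delta>'_def)
    qed
    then obtain \<iota> where \<iota>: "\<And>n. \<iota> n < N" "\<And>n. \<delta>' \<le> norm (inf (p n) (p (\<iota> n)))" by metis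
    have "finite (\<iota> ` UNIV)" using \<iota>(1) by (auto intro: finite_subset[of _ "{..<N}"])
    then obtain m where "infinite {n. \<iota> n = \<iota> m}"
      using pigeonhole_infinite[of UNIV \<iota>] by auto
    then have inf: "infinite ({n. \<iota> n = \<iota> m} - {\<iota> m})" by simp
    define s where "s = enumerate ({n. \<iota> n = \<iota> m} - {\<iota> m})"
    have s: "\<iota> (s j) = \<iota> m" "s j \<noteq> \<iota> m" for j
      using enumerate_in_set[OF inf, of j] by (auto simp: s_def)
    have inj: "inj s" using strict_mono_enumerate[OF inf] by (auto simp: s_def strict_mono_imp_inj_on)
    show False
    proof (rule Suc.IH[of "\<lambda>j. inf (p (s j)) (p (\<iota> m))" \<delta>'])
      show "\<delta>' \<le> norm (inf (p (s j)) (p (\<iota> m)))" for j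
        using \<iota>(2)[of "s j"] s by simp
      show "0 < \<delta>'" using p(4) C' N by (simp add: \<delta>'_def)
      show "inf (p (s j)) (p (\<iota> m)) \<le> u" for j using p(2) by (meson inf.coboundedI1)
      show "d = 0" if F: "finite F" "card F = k" "0 \<le> d"
        "\<And>j. j \<in> F \<Longrightarrow> d \<le> inf (p (s j)) (p (\<iota> m))" for F d
      proof -
        have "F \<noteq> {}" using F(2) \<open>k \<noteq> 0\<close> by auto
        have "card (insert (\<iota> m) (s ` F)) = Suc k"
        proof (subst card_insert_disjoint)
          show "\<iota> m \<notin> s ` F" using s(2) by (metis imageE)
          show "Suc (card (s ` F)) = Suc k"
            using F(2) inj by (simp add: card_image inj_on_subset)
        qed (use F(1) in simp)
        then show ?thesis
          using Suc.prems(5)[of "insert (\<iota> m) (s ` F)" d] F \<open>F \<noteq> {}\<close> by auto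
      qed
    qed (simp add: p(1))
  qed
qed

section \<open>Order bounded sequences\<close>

text \<open>
  A vector \<open>d\<close> below all \<open>pprt (w i - a)\<close> is disjoint from all \<open>pprt (a - w i)\<close>, hence from
  their sum. But that sum dominates \<open>d\<close>, since the \<open>w i\<close> are at most \<open>a\<close> on average.
\<close>

lemma common_minorant_of_excesses_eq_0:
  fixes w :: "'i \<Rightarrow> 'a::banach_lattice"
  assumes F: "finite F" "F \<noteq> {}" and avg: "(\<Sum>i\<in>F. w i) \<le> real (card F) *\<^sub>R a"
    and d: "0 \<le> d" "\<And>i. i \<in> F \<Longrightarrow> d \<le> pprt (w i - a)"
  shows "d = 0"
proof -
  define s where "s = (\<Sum>i\<in>F. pprt (a - w i))"
  have "inf d (pprt (a - w i)) = 0" if "i \<in> F" for i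
    using inf_pprt_pprt_minus[of "w i - a"] by (rule inf_eq_0_mono) (use d that in simp_all)
  then have "inf d s \<le> 0"
    unfolding s_def using inf_sum_le[OF F(1) d(1), of "\<lambda>i. pprt (a - w i)"] by simp
  moreover have "d \<le> s"
  proof -
    obtain i0 where i0: "i0 \<in> F" using F(2) by blast
    have "pprt (w i0 - a) \<le> (\<Sum>i\<in>F. pprt (w i - a))"
      using sum_mono2[of F "{i0}" "\<lambda>i. pprt (w i - a)"] F(1) i0 by simp
    moreover have "s - (\<Sum>i\<in>F. pprt (w i - a)) = (\<Sum>i\<in>F. a - w i)"
    proof -
      have "pprt (a - w i) - pprt (w i - a) = a - w i" for i
        using prts[of "a - w i"] pprt_neg[of "a - w i"] by simp
      then show ?thesis by (simp add: s_def flip: sum_subtractf)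
    qed
    moreover have "0 \<le> (\<Sum>i\<in>F. a - w i)"
      using avg by (simp add: sum_subtractf sum_constant_scaleR)
    ultimately show ?thesis using d(2)[OF i0] by (metis diff_ge_0_iff_ge order.trans)
  qed
  ultimately show "d = 0" using d(1) by (simp add: inf_absorb1)
qed

text \<open>
  If the sequence were not Cauchy, it would have increments \<open>w j\<close> of norm at least \<open>\<epsilon>\<close> with
  partial sums below \<open>u\<close>. For large \<open>k\<close> the vectors \<open>pprt (w j - u / k)\<close> still have norm at
  least \<open>\<epsilon> / 2\<close>, but no \<open>k\<close> of them overlap.
\<close>

lemma monotone_order_bounded_convergent:
  fixes v :: "nat \<Rightarrow> 'a::banach_lattice"
  assumes H: "disjoint_schur_property TYPE('a)"
    and inc: "incseq v" and v: "\<And>n. 0 \<le> v n" "\<And>n. v n \<le> u"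
  shows "convergent v"
proof (rule ccontr)
  assume "\<not> convergent v"
  then have "\<not> Cauchy v" by (simp add: Cauchy_convergent_iff)
  then obtain \<epsilon> where \<epsilon>: "0 < \<epsilon>" "\<And>n. \<exists>m\<ge>n. \<epsilon> \<le> norm (v m - v n)"
    unfolding Cauchy_altdef2 dist_norm by (auto simp: not_less)
  have "\<exists>r. \<forall>k. True \<and> (r k \<le> r (Suc k) \<and> \<epsilon> \<le> norm (v (r (Suc k)) - v (r k)))"
    using \<epsilon>(2) by (intro dependent_nat_choice) auto
  then obtain r where r: "\<And>k. r k \<le> r (Suc k)" "\<And>k. \<epsilon> \<le> norm (v (r (Suc k)) - v (r k))"
    by blast
  define w where "w k = v (r (Suc k)) - v (r k)" for k
  have w: "0 \<le> w k" "w k \<le> u" for k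
    using inc r(1)[of k] v(1)[of "r k"] v(2)[of "r (Suc k)"]
    by (auto simp: w_def incseq_def diff_le_eq add_increasing2)
  have wsum: "(\<Sum>i\<in>F. w i) \<le> u" if fin: "finite F" for F
  proof -
    obtain n where "F \<subseteq> {..<n}" using finite_nat_iff_bounded[THEN iffD1, OF fin] by auto
    then have "(\<Sum>i\<in>F. w i) \<le> (\<Sum>i<n. w i)" using w(1) by (intro sum_mono2) auto
    also have "\<dots> = v (r n) - v (r 0)"
      unfolding w_def by (rule sum_lessThan_telescope)
    also have "\<dots> \<le> u" using v(1)[of "r 0"] v(2)[of "r n"] by (simp add: diff_le_eq add_increasing2)
    finally show ?thesis .
  qed
  obtain k :: nat where k: "2 * norm u / \<epsilon> < k" using reals_Archimedean2 by blast
  have k: "norm u / k \<le> \<epsilon> / 2" "0 < k"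
  proof -
    have "0 \<le> 2 * norm u / \<epsilon>" using \<epsilon>(1) by simp
    then have "0 < real k" using k by linarith
    then show "0 < k" "norm u / k \<le> \<epsilon> / 2" using k \<epsilon>(1) by (auto simp: field_simps)
  qed
  define a where "a = (1 / k) *\<^sub>R u"
  have u: "0 \<le> u" using w[of 0] by (rule order.trans)
  then have a: "0 \<le> a" by (simp add: a_def scaleR_nonneg_nonneg)
  show False
  proof (rule no_bounded_overlap[OF H, of "\<lambda>j. pprt (w j - a)" u "\<epsilon> / 2" k])
    show "pprt (w j - a) \<le> u" for j
      using w(2) a u by (intro pprt_le) (auto simp: diff_le_eq add_increasing2)
    show "\<epsilon> / 2 \<le> norm (pprt (w j - a))" for j
    proof -
      have "norm (w j) \<le> norm (pprt (w j - a) + a)"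
        using pprt_diff_le[OF a, of "w j"] w(1) by (intro norm_mono) auto
      then have "norm (w j) \<le> norm (pprt (w j - a)) + norm a"
        using norm_triangle_ineq order.trans by blast
      moreover have "\<epsilon> \<le> norm (w j)" using r(2)[of j] by (simp add: w_def)
      moreover have "norm a \<le> \<epsilon> / 2" using k by (simp add: a_def)
      ultimately show ?thesis by linarith
    qed
    show "d = 0" if F: "finite F" "card F = k" "0 \<le> d" "\<And>i. i \<in> F \<Longrightarrow> d \<le> pprt (w i - a)" for F d
    proof (rule common_minorant_of_excesses_eq_0[OF F(1) _ _ F(3,4)])
      show "F \<noteq> {}" using F(2) k(2) by auto
      show "(\<Sum>i\<in>F. w i) \<le> real (card F) *\<^sub>R a" using wsum[OF F(1)] F(2) k(2) by (simp add: a_def)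
    qed
  qed (use \<epsilon> in auto)
qed

text \<open>The sum of the \<open>\<phi> j / 2 ^ j\<close> is strictly positive wherever one of the \<open>\<phi> j\<close> is.\<close>

lemma dominating_functional:
  fixes \<phi> :: "nat \<Rightarrow> 'a::banach_lattice \<Rightarrow> real"
  assumes \<phi>: "\<And>j. positive_functional (\<phi> j)" "\<And>j v. \<bar>\<phi> j v\<bar> \<le> norm v"
  obtains \<psi> where "positive_functional \<psi>" "\<And>j v. 0 \<le> v \<Longrightarrow> (1/2) ^ j * \<phi> j v \<le> \<psi> v"
proof
  define \<psi> where "\<psi> v = (\<Sum>j. (1/2) ^ j * \<phi> j v)" for v
  note lin = positive_functional_linear[OF \<phi>(1)]
  have geo: "summable (\<lambda>j. norm v * (1/2::real) ^ j)" "(\<Sum>j. norm v * (1/2::real) ^ j) = 2 * norm v" for v :: 'a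
    using suminf_geometric[of "1/2::real"] by (auto intro!: summable_mult simp: suminf_mult)
  have bnd: "norm ((1/2) ^ j * \<phi> j v) \<le> norm v * (1/2) ^ j" for j v
    using \<phi>(2)[of j v] by (simp add: abs_mult mult.commute)
  have nsum: "summable (\<lambda>j. norm ((1/2) ^ j * \<phi> j v))" for v
    using bnd by (intro summable_comparison_test'[OF geo(1)[of v], where N=0]) simp
  have sum: "summable (\<lambda>j. (1/2) ^ j * \<phi> j v)" for v
    using summable_norm_cancel[OF nsum] .
  have "norm (\<psi> v) \<le> norm v * 2" for v
  proof -
    have "norm (\<psi> v) \<le> (\<Sum>j. norm ((1/2) ^ j * \<phi> j v))"
      unfolding \<psi>_def by (rule summable_norm[OF nsum])
    also have "\<dots> \<le> 2 * norm v" using suminf_le[OF bnd nsum geo(1), of v] unfolding geo(2) .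
    finally show ?thesis by (simp add: mult.commute)
  qed
  moreover have "\<psi> (v + w) = \<psi> v + \<psi> w" for v w
    using suminf_add[OF sum sum, of v w] by (simp add: \<psi>_def linear_add[OF lin] distrib_left)
  moreover have "\<psi> (c *\<^sub>R v) = c *\<^sub>R \<psi> v" for c v
    using suminf_mult[OF sum, of c v] by (simp add: \<psi>_def linear_scale[OF lin] mult.left_commute)
  moreover have "0 \<le> \<psi> v" if "0 \<le> v" for v
    unfolding \<psi>_def using positive_functional_nonneg[OF \<phi>(1) that] by (intro suminf_nonneg sum) simp
  ultimately show "positive_functional \<psi>"
    unfolding positive_functional_def by (auto intro!: bounded_linear_intro)
  show "(1/2) ^ j * \<phi> j v \<le> \<psi> v" if "0 \<le> v" for j v
    using sum_le_suminf[OF sum, of "{j}" v] positive_functional_nonneg[OF \<phi>(1) that]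
    by (simp add: \<psi>_def)
qed

text \<open>
  Finite suprema are indexed by lists, which can be enumerated.
\<close>

definition list_sup :: "(nat \<Rightarrow> 'a::banach_lattice) \<Rightarrow> nat list \<Rightarrow> 'a" where
  "list_sup x l = foldr (\<lambda>i. sup (x i)) l 0"

lemma list_sup_nonneg: "0 \<le> list_sup x l"
  by (induction l) (simp_all add: list_sup_def le_supI2)

lemma list_sup_ge: "i \<in> set l \<Longrightarrow> x i \<le> list_sup x l"
  by (induction l) (auto simp: list_sup_def le_supI2)

lemma list_sup_least: "0 \<le> u \<Longrightarrow> (\<And>i. i \<in> set l \<Longrightarrow> x i \<le> u) \<Longrightarrow> list_sup x l \<le> u"
  by (induction l) (simp_all add: list_sup_def)

lemma list_sup_mono: "set l \<subseteq> set m \<Longrightarrow> list_sup x l \<le> list_sup x m"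
  by (intro list_sup_least list_sup_nonneg list_sup_ge) auto

lemma list_sup_le_sum:
  assumes "\<And>i. 0 \<le> x i"
  shows "list_sup x l \<le> (\<Sum>i\<leftarrow>l. x i)"
proof (induction l)
  case (Cons i l)
  have "sup (x i) (list_sup x l) \<le> x i + list_sup x l"
    using assms[of i] list_sup_nonneg[of x l] by simp
  also have "\<dots> \<le> x i + (\<Sum>i\<leftarrow>l. x i)" using Cons by simp
  finally show ?case by (simp add: list_sup_def)
qed (simp add: list_sup_def)

text \<open>
  The finite suprema of the \<open>x i\<close> are countably many, so that one positive functional \<open>\<psi>\<close> is
  strictly positive on the nonzero positive vectors in the closure of the set of them. Along
  a subsequence with \<open>\<psi> (x (r k)) \<le> 2 ^ -k\<close> the suprema of the tails exist and
  decrease to a vector in this closure at which \<open>\<psi>\<close> vanishes.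
\<close>

lemma order_bounded_weakly_null_subseq:
  fixes x :: "nat \<Rightarrow> 'a::banach_lattice"
  assumes H: "disjoint_schur_property TYPE('a)"
    and x: "weakly_null x" "\<And>n. 0 \<le> x n" "\<And>n. x n \<le> u"
  shows "\<exists>r. strict_mono r \<and> (x \<circ> r) \<longlonglongrightarrow> 0"
proof -
  have u: "0 \<le> u" using x(2,3)[of 0] by (rule order.trans)
  define J where "J j = list_sup x (from_nat j)" for j
  have "\<exists>f. positive_functional f \<and> (\<forall>v. \<bar>f v\<bar> \<le> norm v) \<and> norm (J j) \<le> f (J j)" for j
    using positive_norming_functional[OF list_sup_nonneg[of x "from_nat j"]] unfolding J_def by blast
  then obtain \<phi> where \<phi>: "\<And>j. positive_functional (\<phi> j)" "\<And>j v. \<bar>\<phi> j v\<bar> \<le> norm v"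
      "\<And>j. norm (J j) \<le> \<phi> j (J j)"
    by metis
  obtain \<psi> where \<psi>: "positive_functional \<psi>" "\<And>j v. 0 \<le> v \<Longrightarrow> (1/2) ^ j * \<phi> j v \<le> \<psi> v"
    using dominating_functional[of \<phi>, OF \<phi>(1,2)] by blast
  interpret \<psi>: bounded_linear \<psi> using \<psi>(1) by (simp add: positive_functional_def)
  have ev: "\<exists>n>m. \<psi> (x n) \<le> (1/2) ^ k" for m k
  proof -
    have "\<forall>\<^sub>F n in sequentially. \<psi> (x n) < (1/2) ^ k"
      using weakly_nullD[OF x(1) \<psi>(1)] by (rule order_tendstoD) simp
    then have "\<forall>\<^sub>F n in sequentially. m < n \<and> \<psi> (x n) < (1/2) ^ k"
      using eventually_gt_at_top by (rule eventually_conj[rotated])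
    then obtain n where "m < n \<and> \<psi> (x n) < (1/2) ^ k"
      using eventually_happens'[OF sequentially_bot] by blast
    then show ?thesis by (auto intro: less_imp_le)
  qed
  have "\<exists>r. \<forall>k. \<psi> (x (r k)) \<le> (1/2) ^ k \<and> r k < r (Suc k)"
    by (rule dependent_nat_choice) (use ev in blast)+
  then obtain r where r: "\<And>k. \<psi> (x (r k)) \<le> (1/2) ^ k" "\<And>k. r k < r (Suc k)" by blast
  define z where "z n m = list_sup x (map r [n..<n + m])" for n m
  have z: "0 \<le> z n m" "z n m \<le> u" for n m
    unfolding z_def by (intro list_sup_nonneg list_sup_least u x(3))+
  have "convergent (z n)" for n
    by (rule monotone_order_bounded_convergent[OF H _ z])
      (auto simp: incseq_def z_def intro!: list_sup_mono)
  then obtain Z where Z: "\<And>n. z n \<longlonglongrightarrow> Z n" unfolding convergent_def by metis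
  have z_le_Z: "z n m \<le> Z n" for n m
  proof (rule tendsto_lower_bound_lattice[where s = "\<lambda>k. z n (k + m)"])
    show "(\<lambda>k. z n (k + m)) \<longlonglongrightarrow> Z n" using Z by (rule LIMSEQ_ignore_initial_segment)
    show "z n m \<le> z n (k + m)" for k
      unfolding z_def by (intro list_sup_mono) auto
  qed
  have Z_bounds: "0 \<le> Z n" "Z n \<le> u" for n
    using tendsto_lower_bound_lattice[OF Z z(1)] tendsto_upper_bound_lattice[OF Z z(2)] by auto
  have "Z (Suc n) \<le> Z n" for n
  proof (rule tendsto_upper_bound_lattice[OF Z])
    fix m
    have "z (Suc n) m \<le> z n (Suc m)" unfolding z_def by (intro list_sup_mono) auto
    then show "z (Suc n) m \<le> Z n" using z_le_Z order.trans by blast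
  qed
  then have "convergent (\<lambda>n. u - Z n)"
    by (intro monotone_order_bounded_convergent[OF H, of _ u])
      (use Z_bounds in \<open>auto intro!: incseq_SucI simp: diff_le_eq add_increasing2\<close>)
  then obtain y where "(\<lambda>n. u - Z n) \<longlonglongrightarrow> y" unfolding convergent_def by blast
  then have "(\<lambda>n. u - (u - Z n)) \<longlonglongrightarrow> u - y" by (intro tendsto_diff tendsto_const)
  then obtain \<zeta> where \<zeta>: "Z \<longlonglongrightarrow> \<zeta>" by auto
  have \<zeta>_nonneg: "0 \<le> \<zeta>" using tendsto_lower_bound_lattice[OF \<zeta> Z_bounds(1)] .
  have "\<psi> (z n m) \<le> 2 * (1/2) ^ n" for n m
  proof -
    have "\<psi> (z n m) \<le> \<psi> (\<Sum>i\<leftarrow>map r [n..<n + m]. x i)"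
      unfolding z_def by (intro positive_functional_mono[OF \<psi>(1)] list_sup_le_sum x)
    also have "\<dots> = (\<Sum>i=n..<n + m. \<psi> (x (r i)))"
      by (simp add: o_def interv_sum_list_conv_sum_set_nat \<psi>.sum)
    also have "\<dots> \<le> (\<Sum>i=n..<n + m. (1/2) ^ i)" by (intro sum_mono r)
    also have "\<dots> = 2 * (1/2) ^ n - 2 * (1/2) ^ (n + m)"
      by (induction m) simp_all
    also have "\<dots> \<le> 2 * (1/2) ^ n" by simp
    finally show ?thesis .
  qed
  then have "\<psi> (Z n) \<le> 2 * (1/2) ^ n" for n
    by (intro LIMSEQ_le_const2[OF \<psi>.tendsto[OF Z]]) blast
  moreover have "(\<lambda>n. 2 * (1/2::real) ^ n) \<longlonglongrightarrow> 0"
    by (intro tendsto_mult_right_zero LIMSEQ_realpow_zero) auto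
  ultimately have \<psi>\<zeta>: "\<psi> \<zeta> \<le> 0"
    by (intro LIMSEQ_le[OF \<psi>.tendsto[OF \<zeta>]]) blast+
  have "\<zeta> = 0"
  proof (rule ccontr)
    assume "\<zeta> \<noteq> 0"
    define e where "e = norm \<zeta> / 5"
    have e: "0 < e" using \<open>\<zeta> \<noteq> 0\<close> by (simp add: e_def)
    obtain n where n: "norm (Z n - \<zeta>) < e" using LIMSEQ_D[OF \<zeta> e] by blast
    obtain m where m: "norm (z n m - Z n) < e" using LIMSEQ_D[OF Z e] by blast
    define j where "j = to_nat (map r [n..<n + m])"
    have J: "J j = z n m" by (simp add: J_def j_def z_def)
    have close: "norm (J j - \<zeta>) < 2 * e"
      using norm_triangle_ineq[of "z n m - Z n" "Z n - \<zeta>"] n m by (simp add: J)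
    have "\<phi> j \<zeta> = \<phi> j (J j) - \<phi> j (J j - \<zeta>)"
      by (simp add: linear_diff[OF positive_functional_linear[OF \<phi>(1)]])
    moreover have "\<phi> j (J j - \<zeta>) \<le> norm (J j - \<zeta>)" using \<phi>(2)[of j "J j - \<zeta>"] by simp
    moreover have "norm \<zeta> - norm (J j) \<le> norm (J j - \<zeta>)"
      using norm_triangle_ineq2[of \<zeta> "J j"] by (simp add: norm_minus_commute)
    moreover have "norm \<zeta> = 5 * e" by (simp add: e_def)
    ultimately have "0 < \<phi> j \<zeta>" using \<phi>(3)[of j] close e by linarith
    then have "0 < (1/2) ^ j * \<phi> j \<zeta>" by simp
    then show False using \<psi>(2)[OF \<zeta>_nonneg, of j] \<psi>\<zeta> by linarith
  qed
  then have Z0: "(\<lambda>n. norm (Z n)) \<longlonglongrightarrow> 0" using \<zeta> by (simp add: tendsto_norm_zero)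
  have "norm (x (r n)) \<le> norm (Z n)" for n
  proof -
    have "x (r n) \<le> z n 1" unfolding z_def by (intro list_sup_ge) auto
    then show ?thesis using z_le_Z[of n 1] x(2) by (intro norm_mono) auto
  qed
  then have "(x \<circ> r) \<longlonglongrightarrow> 0"
    using Z0 by (intro Lim_null_comparison[OF _ Z0]) simp
  then show ?thesis using r(2) strict_mono_Suc_iff by blast
qed

lemma order_bounded_weakly_null_tendsto_0:
  fixes x :: "nat \<Rightarrow> 'a::banach_lattice"
  assumes H: "disjoint_schur_property TYPE('a)"
    and x: "weakly_null x" "\<And>n. 0 \<le> x n" "\<And>n. x n \<le> u"
  shows "x \<longlonglongrightarrow> 0"
proof (rule ccontr)
  assume "\<not> x \<longlonglongrightarrow> 0"
  then obtain e where e: "0 < e" "\<And>n0. \<exists>n\<ge>n0. e \<le> norm (x n)"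
    unfolding LIMSEQ_iff by (auto simp: not_less)
  then have inf: "infinite {n. e \<le> norm (x n)}"
    by (simp add: infinite_nat_iff_unbounded_le)
  define s where "s = enumerate {n. e \<le> norm (x n)}"
  have s: "strict_mono s" "\<And>k. e \<le> norm (x (s k))"
    using strict_mono_enumerate[OF inf] enumerate_in_set[OF inf] by (auto simp: s_def)
  have "weakly_null (\<lambda>k. x (s k))"
    using x(1) s(1) x(2) order_refl by (rule weakly_null_dominated)
  then obtain r where "((\<lambda>k. x (s k)) \<circ> r) \<longlonglongrightarrow> 0"
    using order_bounded_weakly_null_subseq[OF H _ x(2,3)] by blast
  then show False
    using not_tendsto_0_if_norm_ge[OF e(1), of "(\<lambda>k. x (s k)) \<circ> r"] s(2) by simp
qed

text \<open>
  Cutting makes a sequence bounded without appeal to the uniform boundedness principle. It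
  leaves the unit ball fixed and sends all other vectors to the unit sphere, so that no
  sequence becomes norm null by it.
\<close>

definition cut_to_unit_ball :: "'a::real_normed_vector \<Rightarrow> 'a" where
  "cut_to_unit_ball v = v /\<^sub>R max 1 (norm v)"

lemma norm_cut_to_unit_ball: "norm (cut_to_unit_ball v) \<le> 1"
  by (simp add: cut_to_unit_ball_def field_simps)

lemma tendsto_0_if_cut_tendsto_0:
  fixes x :: "nat \<Rightarrow> 'a::real_normed_vector"
  assumes "(\<lambda>n. cut_to_unit_ball (x n)) \<longlonglongrightarrow> 0"
  shows "x \<longlonglongrightarrow> 0"
proof -
  have "\<forall>\<^sub>F n in sequentially. norm (cut_to_unit_ball (x n)) < 1"
    using order_tendstoD(2)[OF tendsto_norm_zero[OF assms], of 1] by simp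
  then have "\<forall>\<^sub>F n in sequentially. cut_to_unit_ball (x n) = x n"
  proof (rule eventually_mono)
    fix n assume "norm (cut_to_unit_ball (x n)) < 1"
    then have "norm (x n) \<le> 1" by (cases "x n = 0") (auto simp: cut_to_unit_ball_def max_def split: if_splits)
    then show "cut_to_unit_ball (x n) = x n" by (simp add: cut_to_unit_ball_def max_def)
  qed
  then show ?thesis using assms by (rule Lim_transform_eventually[rotated])
qed

lemma cut_to_unit_ball_bounds:
  fixes v :: "'a::banach_lattice"
  assumes "0 \<le> v"
  shows "0 \<le> cut_to_unit_ball v" "cut_to_unit_ball v \<le> v"
proof -
  show "0 \<le> cut_to_unit_ball v"
    using assms unfolding cut_to_unit_ball_def by (intro scaleR_nonneg_nonneg) auto
  have "inverse (max 1 (norm v)) *\<^sub>R v \<le> 1 *\<^sub>R v"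
    using assms by (intro scaleR_right_mono) (auto simp: inverse_le_1_iff)
  then show "cut_to_unit_ball v \<le> v" by (simp add: cut_to_unit_ball_def)
qed

lemma weakly_null_cut_to_unit_ball:
  fixes x :: "nat \<Rightarrow> 'a::banach_lattice"
  assumes "weakly_null x" "\<And>n. 0 \<le> x n"
  shows "weakly_null (\<lambda>n. cut_to_unit_ball (x n))"
  by (rule weakly_null_dominated[where x = x and r = "\<lambda>n. n"])
    (simp_all add: assms cut_to_unit_ball_bounds strict_mono_def)

text \<open>
  Up to \<open>\<epsilon>\<close> the sequence lies below one vector \<open>v\<close>; split each \<open>y n\<close> into its infimum
  with \<open>v\<close> and its excess over \<open>v\<close>.
\<close>

lemma positive_schur_if_disjoint_schur:
  assumes H: "disjoint_schur_property TYPE('a::banach_lattice)"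
  shows "positive_schur_property TYPE('a)"
  unfolding positive_schur_property_def
proof (intro allI impI, elim conjE)
  fix x :: "nat \<Rightarrow> 'a" assume x: "\<forall>j. 0 \<le> x j" "weakly_null x"
  define y where "y n = cut_to_unit_ball (x n)" for n
  have y: "weakly_null y" "\<And>n. 0 \<le> y n" "\<And>n. norm (y n) \<le> 1"
    unfolding y_def using x
    by (simp_all add: weakly_null_cut_to_unit_ball cut_to_unit_ball_bounds norm_cut_to_unit_ball)
  have "y \<longlonglongrightarrow> 0"
  proof (rule tendstoI)
    fix e :: real assume "0 < e"
    then obtain v where v: "0 \<le> v" "\<And>n. norm (pprt (y n - v)) < e / 2"
      using weakly_null_almost_order_bounded[of y "e / 2", OF H y] by auto
    have "weakly_null (\<lambda>n. inf (y n) v)"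
      by (rule weakly_null_dominated[where x = y and r = "\<lambda>n. n"])
        (simp_all add: y v(1) strict_mono_def)
    then have "(\<lambda>n. inf (y n) v) \<longlonglongrightarrow> 0"
      using y(2) v(1) by (intro order_bounded_weakly_null_tendsto_0[OF H, of _ v]) auto
    then have "\<forall>\<^sub>F n in sequentially. norm (inf (y n) v) < e / 2"
      using order_tendstoD(2)[OF tendsto_norm_zero] \<open>0 < e\<close> half_gt_zero by blast
    then show "\<forall>\<^sub>F n in sequentially. dist (y n) 0 < e"
    proof (rule eventually_mono)
      fix n assume "norm (inf (y n) v) < e / 2"
      then show "dist (y n) 0 < e"
        using norm_triangle_ineq[of "inf (y n) v" "pprt (y n - v)"] v(2)[of n]
        by (simp add: inf_add_pprt_diff)
    qed
  qed
  then show "x \<longlonglongrightarrow> 0" unfolding y_def by (rule tendsto_0_if_cut_tendsto_0)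
qed

section \<open>Multilinear forms\<close>

definition bounded_form :: "nat \<Rightarrow> ((nat \<Rightarrow> 'a::real_normed_vector) \<Rightarrow> real) \<Rightarrow> bool" where
  "bounded_form n A \<longleftrightarrow> multilinear_form n A \<and> (\<exists>K. \<forall>x. \<bar>A x\<bar> \<le> K * (\<Prod>i<n. norm (x i)))"

lemma multilinear_form_cong: "multilinear_form n A \<Longrightarrow> (\<And>i. i < n \<Longrightarrow> x i = y i) \<Longrightarrow> A x = A y"
  by (simp add: multilinear_form_def)

lemma multilinear_form_linear: "multilinear_form n A \<Longrightarrow> i < n \<Longrightarrow> linear (\<lambda>v. A (x(i := v)))"
  by (simp add: multilinear_form_def)

lemma multilinear_form_mono:
  fixes x y :: "nat \<Rightarrow> 'a::banach_lattice"
  assumes A: "multilinear_form n A" and pos: "\<And>x. (\<forall>i<n. 0 \<le> x i) \<Longrightarrow> 0 \<le> A x"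
    and xy: "\<And>i. i < n \<Longrightarrow> 0 \<le> x i" "\<And>i. i < n \<Longrightarrow> x i \<le> y i"
  shows "A x \<le> A y"
proof -
  define w where "w m i = (if i < m then y i else x i)" for m i
  have "A x \<le> A (w m)" if "m \<le> n" for m
    using that
  proof (induction m)
    case 0
    then show ?case by (simp add: w_def)
  next
    case (Suc m)
    have lin: "linear (\<lambda>v. A ((w m)(m := v)))"
      using A Suc.prems by (intro multilinear_form_linear) auto
    have "A (w (Suc m)) - A (w m) = A ((w m)(m := y m)) - A ((w m)(m := x m))"
      by (intro arg_cong2[where f = minus] arg_cong[where f = A]) (auto simp: w_def fun_eq_iff)
    also have "\<dots> = A ((w m)(m := y m - x m))"
      using linear_diff[OF lin] by simp
    also have "0 \<le> \<dots>"
      using xy Suc.prems order.trans[OF xy] by (intro pos) (auto simp: w_def)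
    finally show ?case using Suc by simp
  qed
  from this[of n] have "A x \<le> A (w n)" by simp
  also have "\<dots> = A y" using A by (rule multilinear_form_cong) (simp add: w_def)
  finally show ?thesis .
qed

lemma multilinear_form_scale:
  assumes A: "multilinear_form n A"
  shows "A (\<lambda>i. c i *\<^sub>R x i) = (\<Prod>i<n. c i) * A x"
proof -
  define w where "w m i = (if i < m then c i *\<^sub>R x i else x i)" for m i
  have "A (w m) = (\<Prod>i<m. c i) * A x" if "m \<le> n" for m
    using that
  proof (induction m)
    case 0
    then show ?case by (simp add: w_def)
  next
    case (Suc m)
    have lin: "linear (\<lambda>v. A ((w m)(m := v)))"
      using A Suc.prems by (intro multilinear_form_linear) auto
    have "A (w (Suc m)) = A ((w m)(m := c m *\<^sub>R x m))"
      by (intro arg_cong[where f = A]) (auto simp: w_def fun_eq_iff)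
    also have "\<dots> = c m * A ((w m)(m := x m))"
      using linear_scale[OF lin] by simp
    also have "(w m)(m := x m) = w m" by (auto simp: w_def fun_eq_iff)
    finally show ?case using Suc by simp
  qed
  from this[of n] have "A (w n) = (\<Prod>i<n. c i) * A x" by simp
  moreover have "A (\<lambda>i. c i *\<^sub>R x i) = A (w n)"
    using A by (rule multilinear_form_cong) (simp add: w_def)
  ultimately show ?thesis by simp
qed

text \<open>
  Replacing one argument after the other by its absolute value: splitting it into positive and
  negative part splits the value of \<open>A\<close> into a difference, whose absolute value is
  at most the corresponding sum.
\<close>

lemma multilinear_form_abs_le:
  fixes x :: "nat \<Rightarrow> 'a::banach_lattice"
  assumes A: "multilinear_form n A" and pos: "\<And>x. (\<forall>i<n. 0 \<le> x i) \<Longrightarrow> 0 \<le> A x"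
  shows "\<bar>A x\<bar> \<le> A (\<lambda>i. \<bar>x i\<bar>)"
proof -
  have "\<bar>A x\<bar> \<le> A (\<lambda>i. \<bar>x i\<bar>)" if "m \<le> n" "\<And>i. m \<le> i \<Longrightarrow> i < n \<Longrightarrow> 0 \<le> x i" for m x
    using that
  proof (induction m arbitrary: x)
    case 0
    then have "A x = A (\<lambda>i. \<bar>x i\<bar>)" by (intro multilinear_form_cong[OF A]) simp
    moreover have "0 \<le> A x" using 0 by (intro pos) simp
    ultimately show ?case by simp
  next
    case (Suc m)
    let ?p = "pprt (x m)" and ?q = "pprt (- x m)"
    have lin: "linear (\<lambda>v. A (y(m := v)))" for y
      using A Suc.prems by (intro multilinear_form_linear) auto
    have IH: "\<bar>A (x(m := v))\<bar> \<le> A ((\<lambda>i. \<bar>x i\<bar>)(m := v))" if "0 \<le> v" for v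
    proof -
      have "\<bar>A (x(m := v))\<bar> \<le> A (\<lambda>i. \<bar>(x(m := v)) i\<bar>)"
        using Suc.prems that by (intro Suc.IH) auto
      also have "(\<lambda>i. \<bar>(x(m := v)) i\<bar>) = (\<lambda>i. \<bar>x i\<bar>)(m := v)" using that by auto
      finally show ?thesis .
    qed
    have "A x = A (x(m := ?p - ?q))"
      using prts[of "x m"] pprt_neg[of "x m"] by (simp add: fun_upd_idem)
    also have "\<dots> = A (x(m := ?p)) - A (x(m := ?q))" by (rule linear_diff[OF lin])
    finally have "\<bar>A x\<bar> \<le> \<bar>A (x(m := ?p))\<bar> + \<bar>A (x(m := ?q))\<bar>" by simp
    also have "\<dots> \<le> A ((\<lambda>i. \<bar>x i\<bar>)(m := ?p)) + A ((\<lambda>i. \<bar>x i\<bar>)(m := ?q))"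
      by (intro add_mono IH) simp_all
    also have "\<dots> = A ((\<lambda>i. \<bar>x i\<bar>)(m := ?p + ?q))" by (rule linear_add[OF lin, symmetric])
    also have "(\<lambda>i. \<bar>x i\<bar>)(m := ?p + ?q) = (\<lambda>i. \<bar>x i\<bar>)"
      by (auto simp: fun_eq_iff abs_prts pprt_neg)
    finally show ?case .
  qed
  from this[of n x] show ?thesis by simp
qed

text \<open>
  A positive form that is unbounded on unit vectors takes arbitrarily large values on
  multiples \<open>2 ^ -k\<close> of unit vectors. In each coordinate these are dominated by a single
  vector, at which the form would be infinite.
\<close>

lemma positive_form_bounded:
  fixes A :: "(nat \<Rightarrow> 'a::banach_lattice) \<Rightarrow> real"
  assumes A: "multilinear_form n A" and pos: "\<And>x. (\<forall>i<n. 0 \<le> x i) \<Longrightarrow> 0 \<le> A x"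
  shows "bounded_form n A"
proof -
  have "\<exists>K. \<forall>x. (\<forall>i. 0 \<le> x i \<and> norm (x i) \<le> 1) \<longrightarrow> A x \<le> K"
  proof (rule ccontr)
    assume "\<not> ?thesis"
    then have "\<exists>x. (\<forall>i. 0 \<le> x i \<and> norm (x i) \<le> 1) \<and> real k * (2 ^ k) ^ n < A x" for k :: nat
      by (meson not_le)
    then obtain x where x: "\<And>k i. 0 \<le> x k i" "\<And>k i. norm (x k i) \<le> 1"
        and big: "\<And>k::nat. real k * (2 ^ k) ^ n < A (x k)"
      by metis
    have "\<exists>s. \<forall>k. (1/2) ^ k *\<^sub>R x k i \<le> s" for i
      using geometric_majorant[of "\<lambda>k. x k i", OF x] by metis
    then obtain s where s: "\<And>i k. (1/2) ^ k *\<^sub>R x k i \<le> s i" by metis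
    have "real k < A s" for k
    proof -
      have "real k < (\<Prod>i<n. (1/2) ^ k) * A (x k)"
        using big[of k] by (simp add: power_one_over field_simps)
      also have "\<dots> = A (\<lambda>i. (1/2) ^ k *\<^sub>R x k i)"
        by (rule multilinear_form_scale[OF A, symmetric])
      also have "\<dots> \<le> A s"
        using s x(1) by (intro multilinear_form_mono[OF A pos]) (auto intro: scaleR_nonneg_nonneg)
      finally show ?thesis .
    qed
    then show False using reals_Archimedean2[of "A s"] by (meson less_asym)
  qed
  then obtain K where K: "\<And>x. (\<And>i. 0 \<le> x i) \<Longrightarrow> (\<And>i. norm (x i) \<le> 1) \<Longrightarrow> A x \<le> K" by blast
  have "\<bar>A x\<bar> \<le> K * (\<Prod>i<n. norm (x i))" for x
  proof -
    define u where "u i = \<bar>x i\<bar> /\<^sub>R norm (x i)" for i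
    have abs: "\<bar>x i\<bar> = norm (x i) *\<^sub>R u i" for i
      by (cases "x i = 0") (simp_all add: u_def)
    have "\<bar>A x\<bar> \<le> A (\<lambda>i. \<bar>x i\<bar>)" by (rule multilinear_form_abs_le[OF A pos])
    also have "\<dots> = (\<Prod>i<n. norm (x i)) * A u"
      unfolding abs by (rule multilinear_form_scale[OF A])
    also have "\<dots> \<le> (\<Prod>i<n. norm (x i)) * K"
    proof (intro mult_left_mono prod_nonneg K)
      show "0 \<le> u i" for i unfolding u_def by (intro scaleR_nonneg_nonneg) auto
      show "norm (u i) \<le> 1" for i by (cases "x i = 0") (simp_all add: u_def)
      show "\<And>i. i \<in> {..<n} \<Longrightarrow> 0 \<le> norm (x i)" by simp
    qed
    finally show ?thesis by (simp add: mult.commute)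
  qed
  then show ?thesis using A by (auto simp: bounded_form_def)
qed

section \<open>Operators into the space of null sequences\<close>

lemma Hausdorff_weak_topology:
  assumes "\<And>u v. u \<in> pts F \<Longrightarrow> v \<in> pts F \<Longrightarrow> u \<noteq> v \<Longrightarrow> \<exists>f. vfunctional F f \<and> f u \<noteq> f v"
  shows "Hausdorff_space (weak_topology F)"
  unfolding Hausdorff_space_def
proof (intro allI impI)
  fix u v assume uv: "u \<in> topspace (weak_topology F) \<and> v \<in> topspace (weak_topology F) \<and> u \<noteq> v"
  then have p: "u \<in> pts F" "v \<in> pts F" by (simp_all add: topspace_weak_topology)
  then obtain f where f: "vfunctional F f" "f u \<noteq> f v" using assms uv by blast
  obtain U V where UV: "open U" "open V" "f u \<in> U" "f v \<in> V" "U \<inter> V = {}"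
    using hausdorff[OF f(2)] by blast
  show "\<exists>U V. openin (weak_topology F) U \<and> openin (weak_topology F) V \<and> u \<in> U \<and> v \<in> V \<and> disjnt U V"
  proof (intro exI conjI)
    show "openin (weak_topology F) {w \<in> pts F. f w \<in> U}" "openin (weak_topology F) {w \<in> pts F. f w \<in> V}"
      using f(1) UV by (simp_all add: openin_weak_topology)
    show "disjnt {w \<in> pts F. f w \<in> U} {w \<in> pts F. f w \<in> V}" using UV(5) by (auto simp: disjnt_def)
  qed (use p UV in auto)
qed

lemma continuous_map_weak_topology:
  assumes "h \<in> topspace X \<rightarrow> pts F"
    and "\<And>g. vfunctional F g \<Longrightarrow> continuous_map X euclideanreal (g \<circ> h)"
  shows "continuous_map X (weak_topology F) h"
  unfolding weak_topology_def
proof (rule continuous_on_generated_topo)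
  fix W assume "W \<in> {{u \<in> pts F. g u \<in> U} | g U. vfunctional F g \<and> open U}"
  then obtain g U where W: "W = {u \<in> pts F. g u \<in> U}" and g: "vfunctional F g" and U: "open U"
    by blast
  have "h -` W \<inter> topspace X = {t \<in> topspace X. (g \<circ> h) t \<in> U}"
    using assms(1) by (auto simp: W)
  then show "openin X (h -` W \<inter> topspace X)"
    using openin_continuous_map_preimage[OF assms(2)[OF g], of U] U by simp
next
  show "h ` topspace X \<subseteq> \<Union> {{u \<in> pts F. g u \<in> U} | g U. vfunctional F g \<and> open U}"
    using assms(1) topspace_weak_topology[of F] by (auto simp: weak_topology_def)
qed

lemma weakly_compact_operatorI:
  assumes T: "bounded_operator F T" and K: "compactin (weak_topology F) K"
    and haus: "Hausdorff_space (weak_topology F)" and sub: "T ` cball 0 1 \<subseteq> K"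
  shows "weakly_compact_operator F T"
proof -
  have "weak_topology F closure_of (T ` cball 0 1) \<subseteq> K"
    using sub compactin_imp_closedin[OF haus K] by (rule closure_of_minimal)
  then show ?thesis
    using T closed_compactin[OF K] by (simp add: weakly_compact_operator_def)
qed

definition null_sequences :: "(nat \<Rightarrow>\<^sub>C real) set" where
  "null_sequences = {b. apply_bcontfun b \<longlonglongrightarrow> 0}"

definition null_sequence_space :: "(nat \<Rightarrow>\<^sub>C real) normed_structure" where
  "null_sequence_space =
     \<lparr>pts = null_sequences, vadd = (+), vzero = 0, vscale = scaleR, vnorm = norm\<rparr>"

lemma apply_Bcontfun_nat:
  fixes u :: "nat \<Rightarrow> real"
  assumes "\<And>n. \<bar>u n\<bar> \<le> M"
  shows "apply_bcontfun (Bcontfun u) = u"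
  using assms by (subst Bcontfun_inverse) (auto simp: bcontfun_def bounded_iff)

lemma abs_apply_le_norm: "\<bar>apply_bcontfun b n\<bar> \<le> norm (b :: nat \<Rightarrow>\<^sub>C real)"
  using norm_bounded[of b n] by simp

lemma complete_null_sequences: "complete null_sequences"
proof (rule complete_closed_subset[OF _ subset_UNIV complete_bounded_sequences])
  show "closed null_sequences"
    unfolding closed_sequential_limits
  proof (intro allI impI, elim conjE)
    fix f and l :: "nat \<Rightarrow>\<^sub>C real"
    assume f: "\<forall>n. f n \<in> null_sequences" "f \<longlonglongrightarrow> l"
    have "apply_bcontfun l \<longlonglongrightarrow> 0"
    proof (rule LIMSEQ_I)
      fix e :: real assume e: "0 < e"
      obtain k where k: "norm (f k - l) < e / 2" using LIMSEQ_D[OF f(2), of "e / 2"] e by auto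
      have "apply_bcontfun (f k) \<longlonglongrightarrow> 0" using f(1) by (simp add: null_sequences_def)
      then obtain N where N: "\<And>n. N \<le> n \<Longrightarrow> \<bar>apply_bcontfun (f k) n\<bar> < e / 2"
        using LIMSEQ_D[of "apply_bcontfun (f k)" 0 "e / 2"] e by auto
      have "\<bar>apply_bcontfun l n\<bar> < e" if "N \<le> n" for n
        using N[OF that] k abs_apply_le_norm[of "f k - l" n] by simp
      then show "\<exists>N. \<forall>n\<ge>N. norm (apply_bcontfun l n - 0) < e" by auto
    qed
    then show "l \<in> null_sequences" by (simp add: null_sequences_def)
  qed
qed

lemma null_sequences_closed:
  "0 \<in> null_sequences"
  "b \<in> null_sequences \<Longrightarrow> c \<in> null_sequences \<Longrightarrow> b + c \<in> null_sequences"
  "b \<in> null_sequences \<Longrightarrow> r *\<^sub>R b \<in> null_sequences"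
  by (auto simp: null_sequences_def intro: tendsto_eq_intros tendsto_mult_right_zero)

lemma banach_space_null_sequences: "banach_space null_sequence_space"
proof -
  have d: "vdist null_sequence_space a b = dist a b" for a b
    by (simp add: vdist_def null_sequence_space_def dist_norm)
  have "\<exists>l\<in>null_sequences. (\<lambda>n. vdist null_sequence_space (s n) l) \<longlonglongrightarrow> 0"
    if s: "\<forall>n. s n \<in> null_sequences"
      "\<forall>\<epsilon>>0. \<exists>N. \<forall>m\<ge>N. \<forall>n\<ge>N. vdist null_sequence_space (s m) (s n) < \<epsilon>" for s
  proof -
    have "Cauchy s" using s(2) unfolding Cauchy_def d by blast
    then obtain l where "l \<in> null_sequences" "s \<longlonglongrightarrow> l"
      using complete_null_sequences s(1) unfolding complete_def by blast
    then show ?thesis unfolding d by (auto simp: tendsto_dist_iff[symmetric])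
  qed
  then show ?thesis
    by unfold_locales
      (auto simp: null_sequence_space_def null_sequences_closed algebra_simps norm_triangle_ineq)
qed

lemma vfunctional_coordinate: "vfunctional null_sequence_space (\<lambda>b. apply_bcontfun b n)"
  unfolding vfunctional_def
  by (auto simp: null_sequence_space_def abs_apply_le_norm intro!: exI[of _ 1])

lemma Hausdorff_null_sequence_space: "Hausdorff_space (weak_topology null_sequence_space)"
proof (rule Hausdorff_weak_topology)
  fix u v :: "nat \<Rightarrow>\<^sub>C real" assume "u \<noteq> v"
  then obtain n where "apply_bcontfun u n \<noteq> apply_bcontfun v n" using bcontfun_eqI by blast
  then show "\<exists>f. vfunctional null_sequence_space f \<and> f u \<noteq> f v"
    using vfunctional_coordinate by blast
qed

text \<open>
  The dual of the space of null sequences consists of the summable sequences: truncations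
  converge in norm to a null sequence, and \<open>g\<close> of a truncation is a finite sum.
  Truncated sequences of signs show the summability.
\<close>

lemma null_sequence_functional:
  assumes g: "vfunctional null_sequence_space g"
  obtains a :: "nat \<Rightarrow> real" where "summable (\<lambda>i. \<bar>a i\<bar>)"
    "\<And>b. b \<in> null_sequences \<Longrightarrow> (\<lambda>i. apply_bcontfun b i * a i) sums g b"
proof -
  have add: "g (b + c) = g b + g c" if "b \<in> null_sequences" "c \<in> null_sequences" for b c
    using g that by (simp add: vfunctional_def null_sequence_space_def)
  have scale: "g (r *\<^sub>R b) = r * g b" if "b \<in> null_sequences" for b r
    using g that by (simp add: vfunctional_def null_sequence_space_def)
  have "\<exists>K. \<forall>b\<in>null_sequences. \<bar>g b\<bar> \<le> K * norm b"
    using g by (simp add: vfunctional_def null_sequence_space_def)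
  then obtain K where "\<And>b. b \<in> null_sequences \<Longrightarrow> \<bar>g b\<bar> \<le> K * norm b" by blast
  then have K: "\<bar>g b\<bar> \<le> \<bar>K\<bar> * norm b" if "b \<in> null_sequences" for b
    using that by (meson abs_ge_self mult_right_mono norm_ge_zero order.trans)
  define P where "P N u = Bcontfun (\<lambda>i. if i < N then u i else 0)" for N and u :: "nat \<Rightarrow> real"
  have P: "apply_bcontfun (P N u) i = (if i < N then u i else 0)" for N u i
  proof -
    have "\<bar>if i < N then u i else 0\<bar> \<le> (\<Sum>j<N. \<bar>u j\<bar>)" for i
      using member_le_sum[of i "{..<N}" "\<lambda>j. \<bar>u j\<bar>"] by (auto simp: sum_nonneg)
    from apply_Bcontfun_nat[OF this] show ?thesis by (simp add: P_def)
  qed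
  have P_null: "P N u \<in> null_sequences" for N u
    unfolding null_sequences_def mem_Collect_eq
    by (rule tendsto_eventually) (auto simp: P eventually_at_top_linorder intro: exI[of _ N])
  define e where "e i = P (Suc i) (\<lambda>j. if j = i then 1 else 0)" for i
  define a where "a i = g (e i)" for i
  have gP: "g (P N u) = (\<Sum>i<N. u i * a i)" for N u
  proof (induction N)
    case 0
    have "P 0 u = 0" by (intro bcontfun_eqI) (simp add: P)
    then show ?case using scale[OF null_sequences_closed(1), of 0] by simp
  next
    case (Suc N)
    have "P (Suc N) u = P N u + u N *\<^sub>R e N"
      by (intro bcontfun_eqI) (auto simp: P e_def less_Suc_eq)
    then show ?case
      using Suc by (simp add: add scale P_null null_sequences_closed e_def a_def)
  qed
  have "(\<Sum>i<N. \<bar>a i\<bar>) \<le> \<bar>K\<bar>" for N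
  proof -
    have "(\<Sum>i<N. \<bar>a i\<bar>) = g (P N (\<lambda>i. sgn (a i)))"
      unfolding gP by (simp add: abs_sgn mult.commute)
    also have "\<dots> \<le> \<bar>K\<bar> * norm (P N (\<lambda>i. sgn (a i)))"
      using K[OF P_null] by (meson abs_ge_self order.trans)
    also have "\<dots> \<le> \<bar>K\<bar> * 1"
      by (intro mult_left_mono norm_bound) (auto simp: P sgn_if)
    finally show ?thesis by simp
  qed
  then have "summable (\<lambda>i. \<bar>a i\<bar>)" by (intro summableI_nonneg_bounded) auto
  moreover have "(\<lambda>i. apply_bcontfun b i * a i) sums g b" if b: "b \<in> null_sequences" for b
    unfolding sums_def
  proof (rule LIMSEQ_I)
    fix r :: real assume r: "0 < r"
    define \<eta> where "\<eta> = r / (\<bar>K\<bar> + 1)"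
    have pos: "0 < \<bar>K\<bar> + 1" by linarith
    then have "0 < \<eta>" "(\<bar>K\<bar> + 1) * \<eta> = r" using r by (simp_all add: \<eta>_def)
    then have \<eta>: "0 < \<eta>" "\<bar>K\<bar> * \<eta> < r" by (simp_all add: distrib_right)
    obtain N0 where N0: "\<And>n. N0 \<le> n \<Longrightarrow> \<bar>apply_bcontfun b n\<bar> < \<eta>"
      using b LIMSEQ_D[of "apply_bcontfun b" 0 \<eta>] \<eta>(1) by (auto simp: null_sequences_def)
    have "norm ((\<Sum>i<N. apply_bcontfun b i * a i) - g b) < r" if "N0 \<le> N" for N
    proof -
      let ?d = "P N (apply_bcontfun b) + (-1) *\<^sub>R b"
      have "norm ?d \<le> \<eta>"
        using N0 that \<eta>(1) by (intro norm_bound) (auto simp: P intro: less_imp_le)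
      then have "\<bar>K\<bar> * norm ?d \<le> \<bar>K\<bar> * \<eta>" by (intro mult_left_mono) auto
      moreover have "\<bar>g ?d\<bar> \<le> \<bar>K\<bar> * norm ?d"
        by (intro K null_sequences_closed P_null b)
      moreover have "g ?d = g (P N (apply_bcontfun b)) + (-1) * g b"
        by (simp only: add scale b P_null null_sequences_closed)
      ultimately show ?thesis using \<eta>(2) by (simp add: gP)
    qed
    then show "\<exists>N0. \<forall>N\<ge>N0. norm ((\<Sum>i<N. apply_bcontfun b i * a i) - g b) < r" by blast
  qed
  ultimately show thesis by (rule that)
qed

text \<open>
  The closed unit ball of the dual, as a set of bare functions: thus it carries the topology
  of pointwise convergence.
\<close>

definition dual_ball :: "('b::real_normed_vector \<Rightarrow> real) set" where
  "dual_ball = {\<phi>. linear \<phi> \<and> (\<forall>f. \<bar>\<phi> f\<bar> \<le> norm f)}"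

text \<open>
  Alaoglu's theorem: linearity is a closed condition on a product of compact intervals.
\<close>

lemma compact_dual_ball: "compact (dual_ball :: ('b::real_normed_vector \<Rightarrow> real) set)"
proof -
  let ?B = "\<Pi>\<^sub>E f\<in>(UNIV :: 'b set). cball 0 (norm f) :: real set"
  have "compactin (product_topology (\<lambda>f::'b. euclideanreal) UNIV) ?B"
    unfolding compactin_PiE by (auto simp: compactin_euclidean_iff)
  then have "compact ?B"
    by (simp add: euclidean_product_topology compactin_euclidean_iff)
  moreover have "closed {\<phi> :: 'b \<Rightarrow> real. (\<forall>f g. \<phi> (f + g) = \<phi> f + \<phi> g) \<and> (\<forall>r f. \<phi> (r *\<^sub>R f) = r * \<phi> f)}"
    by (intro closed_Collect_conj closed_Collect_all closed_Collect_eq continuous_intros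
        continuous_on_product_coordinates)
  ultimately have "compact (?B \<inter> {\<phi>. (\<forall>f g. \<phi> (f + g) = \<phi> f + \<phi> g) \<and> (\<forall>r f. \<phi> (r *\<^sub>R f) = r * \<phi> f)})"
    by (rule compact_Int_closed)
  also have "?B \<inter> {\<phi>. (\<forall>f g. \<phi> (f + g) = \<phi> f + \<phi> g) \<and> (\<forall>r f. \<phi> (r *\<^sub>R f) = r * \<phi> f)} = dual_ball"
    by (auto simp: dual_ball_def linear_iff PiE_iff)
  finally show ?thesis .
qed

text \<open>
  Let \<open>f\<close> be weakly null in the dual. The operator \<open>v \<mapsto> (f n v)\<close> into the null sequences is
  weakly compact: the image of the unit ball lies in the set of all sequences \<open>(\<phi> (f n))\<close> with
  \<open>\<phi>\<close> in the unit ball of the bidual, which is a continuous image of a compact space.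
\<close>

lemma weakly_compact_evaluations:
  fixes f :: "nat \<Rightarrow> 'a::real_normed_vector \<Rightarrow>\<^sub>L real"
  assumes null: "weakly_null f" and M: "\<And>n. norm (f n) \<le> M"
  shows "weakly_compact_operator null_sequence_space (\<lambda>v. Bcontfun (\<lambda>n. f n v))"
    (is "weakly_compact_operator _ ?T")
proof (rule weakly_compact_operatorI[OF _ _ Hausdorff_null_sequence_space])
  have fv: "\<bar>f n v\<bar> \<le> M * norm v" for n v
    using norm_blinfun[of "f n" v] mult_right_mono[OF M[of n], of "norm v"] by simp
  have T: "apply_bcontfun (?T v) = (\<lambda>n. f n v)" for v
    using fv by (intro apply_Bcontfun_nat)
  have T_null: "?T v \<in> null_sequences" for v
  proof -
    have "bounded_linear (\<lambda>h :: 'a \<Rightarrow>\<^sub>L real. h v)" by (rule bounded_linear_intros)+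
    then have "(\<lambda>n. blinfun_apply (f n) v) \<longlonglongrightarrow> 0"
      using null[unfolded weakly_null_def, rule_format] by blast
    then show ?thesis by (simp add: null_sequences_def T)
  qed
  have "norm (?T v) \<le> M * norm v" for v
    using fv by (intro norm_bound) (simp add: T)
  moreover have "?T (v + w) = ?T v + ?T w" for v w
    by (rule bcontfun_eqI) (simp only: T plus_bcontfun.rep_eq, simp add: blinfun.add_right)
  moreover have "?T (c *\<^sub>R v) = c *\<^sub>R ?T v" for v c
    by (rule bcontfun_eqI) (simp only: T scaleR_bcontfun.rep_eq, simp add: blinfun.scaleR_right)
  ultimately show "bounded_operator null_sequence_space ?T"
    unfolding bounded_operator_def using T_null by (auto simp: null_sequence_space_def)
  define \<Psi> where "\<Psi> \<phi> = Bcontfun (\<lambda>n. \<phi> (f n))" for \<phi> :: "('a \<Rightarrow>\<^sub>L real) \<Rightarrow> real"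
  have bl: "bounded_linear \<phi>" if "\<phi> \<in> dual_ball" for \<phi> :: "('a \<Rightarrow>\<^sub>L real) \<Rightarrow> real"
    using that by (auto simp: dual_ball_def linear_iff intro!: bounded_linear_intro[of _ 1])
  have \<Psi>: "apply_bcontfun (\<Psi> \<phi>) = (\<lambda>n. \<phi> (f n))" if "\<phi> \<in> dual_ball" for \<phi>
    unfolding \<Psi>_def
  proof (rule apply_Bcontfun_nat)
    show "\<bar>\<phi> (f n)\<bar> \<le> M" for n
      using that M[of n] by (auto simp: dual_ball_def intro: order.trans)
  qed
  have \<Psi>_null: "\<Psi> \<phi> \<in> null_sequences" if "\<phi> \<in> dual_ball" for \<phi>
    using null bl[OF that] by (simp add: null_sequences_def \<Psi>[OF that] weakly_null_def)
  have cont: "continuous_map (top_of_set dual_ball) (weak_topology null_sequence_space) \<Psi>"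
  proof (rule continuous_map_weak_topology)
    show "\<Psi> \<in> topspace (top_of_set dual_ball) \<rightarrow> pts null_sequence_space"
      using \<Psi>_null by (auto simp: null_sequence_space_def)
    fix g assume "vfunctional null_sequence_space g"
    then obtain a :: "nat \<Rightarrow> real" where a: "summable (\<lambda>i. \<bar>a i\<bar>)"
        "\<And>b. b \<in> null_sequences \<Longrightarrow> (\<lambda>i. apply_bcontfun b i * a i) sums g b"
      by (rule null_sequence_functional) blast
    have "summable (\<lambda>i. norm (a i *\<^sub>R f i))"
    proof (rule summable_comparison_test'[OF summable_mult2[OF a(1), of M], where N = 0])
      show "norm (norm (a n *\<^sub>R f n)) \<le> \<bar>a n\<bar> * M" for n
        using M[of n] by (simp add: mult_left_mono)
    qed
    then have sm: "summable (\<lambda>i. a i *\<^sub>R f i)" by (rule summable_norm_cancel)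
    have "g (\<Psi> \<phi>) = \<phi> (\<Sum>i. a i *\<^sub>R f i)" if \<phi>: "\<phi> \<in> dual_ball" for \<phi>
    proof -
      interpret bounded_linear \<phi> by (rule bl[OF \<phi>])
      have "(\<lambda>i. \<phi> (a i *\<^sub>R f i)) sums \<phi> (\<Sum>i. a i *\<^sub>R f i)"
        by (rule sums[OF summable_sums[OF sm]])
      then show ?thesis
        using a(2)[OF \<Psi>_null[OF \<phi>]] sums_unique2 by (simp add: \<Psi>[OF \<phi>] scaleR mult.commute) blast
    qed
    moreover have "continuous_on dual_ball (\<lambda>\<phi> :: ('a \<Rightarrow>\<^sub>L real) \<Rightarrow> real. \<phi> (\<Sum>i. a i *\<^sub>R f i))"
      by (rule continuous_on_product_coordinates[THEN continuous_on_subset]) simp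
    ultimately show "continuous_map (top_of_set dual_ball) euclideanreal (g \<circ> \<Psi>)"
      by (simp add: continuous_map_iff_continuous cong: continuous_on_cong)
  qed
  have "compactin (top_of_set dual_ball) (dual_ball :: (('a \<Rightarrow>\<^sub>L real) \<Rightarrow> real) set)"
    by (simp add: compactin_subtopology compactin_euclidean_iff compact_dual_ball)
  then show "compactin (weak_topology null_sequence_space) (\<Psi> ` dual_ball)"
    by (rule image_compactin[OF _ cont])
  show "?T ` cball 0 1 \<subseteq> \<Psi> ` dual_ball"
  proof (rule image_subsetI)
    fix v :: 'a assume v: "v \<in> cball 0 1"
    have "\<bar>h v\<bar> \<le> norm h" for h :: "'a \<Rightarrow>\<^sub>L real"
      using norm_blinfun[of h v] mult_left_mono[of "norm v" 1 "norm h"] v by simp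
    then have "(\<lambda>h. blinfun_apply h v) \<in> dual_ball"
      by (auto simp: dual_ball_def linear_iff blinfun.add_left blinfun.scaleR_left)
    moreover have "?T v = \<Psi> (\<lambda>h. h v)" by (simp add: \<Psi>_def)
    ultimately show "?T v \<in> \<Psi> ` dual_ball" by blast
  qed
qed

lemma weak_dunford_pettis_functionals:
  fixes x :: "nat \<Rightarrow> 'a::banach_lattice" and f :: "nat \<Rightarrow> 'a \<Rightarrow>\<^sub>L real"
  assumes wdp: "weak_dunford_pettis_property TYPE('a)"
    and x: "weakly_null x" "pairwise_disjoint_seq x"
    and f: "weakly_null f" "\<And>n. norm (f n) \<le> M"
  shows "(\<lambda>j. blinfun_apply (f j) (x j)) \<longlonglongrightarrow> 0"
proof -
  let ?T = "\<lambda>v. Bcontfun (\<lambda>n. blinfun_apply (f n) v)"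
  have "(\<lambda>j. vnorm null_sequence_space (?T (x j))) \<longlonglongrightarrow> 0"
    using weak_dunford_pettis_any_space[OF wdp, where 'v = "nat \<Rightarrow>\<^sub>C real"]
      banach_space_null_sequences weakly_compact_evaluations[OF f] x
    unfolding weak_dunford_pettis_into_def by blast
  then have lim: "(\<lambda>j. norm (?T (x j))) \<longlonglongrightarrow> 0" by (simp add: null_sequence_space_def)
  have "norm (f j (x j)) \<le> norm (?T (x j))" for j
  proof -
    have "\<bar>f n (x j)\<bar> \<le> M * norm (x j)" for n
      using norm_blinfun[of "f n" "x j"] mult_right_mono[OF f(2)[of n], of "norm (x j)"] by simp
    then have "apply_bcontfun (?T (x j)) = (\<lambda>n. f n (x j))" by (rule apply_Bcontfun_nat)
    then show ?thesis using abs_apply_le_norm[of "?T (x j)" j] by simp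
  qed
  then show ?thesis by (intro Lim_null_comparison[OF _ lim]) simp
qed

section \<open>Polynomials and the theorem\<close>

text \<open>
  Induction on the degree. Freezing all arguments but the last at \<open>x j\<close> gives functionals
  \<open>f j\<close> in the dual. They are weakly null: applying an element of the bidual to them
  yields a form of smaller degree evaluated at \<open>x j\<close>. So \<open>A (x j, \<dots>, x j) = f j (x j)\<close>
  tends to \<open>0\<close> by the weak Dunford-Pettis property.
\<close>

lemma bounded_form_tendsto_0:
  fixes x :: "nat \<Rightarrow> 'a::banach_lattice"
  assumes wdp: "weak_dunford_pettis_property TYPE('a)"
    and x: "weakly_null x" "pairwise_disjoint_seq x" "\<And>j. norm (x j) \<le> 1"
    and A: "bounded_form (Suc n) A"
  shows "(\<lambda>j. A (\<lambda>_. x j)) \<longlonglongrightarrow> 0"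
  using A
proof (induction n arbitrary: A)
  case 0
  then have A: "multilinear_form (Suc 0) A" by (simp add: bounded_form_def)
  have upd: "A (\<lambda>_. v) = A ((\<lambda>_. 0)(0 := v))" for v
    by (rule multilinear_form_cong[OF A]) simp
  obtain K where "\<And>y. \<bar>A y\<bar> \<le> K * (\<Prod>i<Suc 0. norm (y i))"
    using 0 by (auto simp: bounded_form_def)
  then have K: "\<bar>A (\<lambda>_. v)\<bar> \<le> norm v * K" for v
    using spec[of _ "\<lambda>_. v"] by (simp add: mult.commute)
  have "linear (\<lambda>v. A ((\<lambda>_. 0)(0 := v)))" using A by (rule multilinear_form_linear) simp
  then have "bounded_linear (\<lambda>v. A (\<lambda>_. v))"
    using K unfolding upd[symmetric] linear_iff by (intro bounded_linear_intro[of _ K]) auto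
  from x(1)[unfolded weakly_null_def, rule_format, OF this] show ?case .
next
  case (Suc n)
  define m where "m = Suc n"
  have A: "multilinear_form (Suc m) A" using Suc.prems by (simp add: bounded_form_def m_def)
  obtain K0 where K0: "\<And>y. \<bar>A y\<bar> \<le> K0 * (\<Prod>i<Suc m. norm (y i))"
    using Suc.prems by (auto simp: bounded_form_def m_def)
  define K where "K = \<bar>K0\<bar>"
  have K: "\<bar>A y\<bar> \<le> K * (\<Prod>i<Suc m. norm (y i))" for y
    using K0[of y] mult_right_mono[OF abs_ge_self[of K0], of "\<Prod>i<Suc m. norm (y i)"]
    unfolding K_def by (meson order.trans prod_nonneg norm_ge_zero)
  have lin: "linear (\<lambda>v. A (y(i := v)))" if "i \<le> m" for y i
    using A that by (intro multilinear_form_linear) auto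
  define L where "L y = Blinfun (\<lambda>v. A (y(m := v)))" for y
  have bound: "\<bar>A (y(m := v))\<bar> \<le> (K * (\<Prod>i<m. norm (y i))) * norm v" for y v
    using K[of "y(m := v)"] by (simp add: mult.assoc)
  have L: "blinfun_apply (L y) v = A (y(m := v))" for y v
  proof -
    have "bounded_linear (\<lambda>v. A (y(m := v)))"
      using lin[of m y] bound[of y] unfolding linear_iff
      by (intro bounded_linear_intro[of _ "K * (\<Prod>i<m. norm (y i))"]) (auto simp: mult.commute)
    then show ?thesis by (simp add: L_def bounded_linear_Blinfun_apply)
  qed
  have L_norm: "norm (L y) \<le> K * (\<Prod>i<m. norm (y i))" for y
    using bound by (intro norm_blinfun_bound) (auto simp: L K_def prod_nonneg)
  define f where "f j = L (\<lambda>_. x j)" for j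
  have "weakly_null f"
    unfolding weakly_null_def
  proof (intro allI impI)
    fix \<phi> :: "('a \<Rightarrow>\<^sub>L real) \<Rightarrow> real" assume "bounded_linear \<phi>"
    then interpret \<phi>: bounded_linear \<phi> .
    obtain C where C: "\<And>h. \<bar>\<phi> h\<bar> \<le> norm h * C" "0 \<le> C"
      using \<phi>.nonneg_bounded by auto
    have "multilinear_form m (\<lambda>y. \<phi> (L y))"
      unfolding multilinear_form_def
    proof (intro conjI allI impI)
      fix y z :: "nat \<Rightarrow> 'a" assume "\<forall>i<m. y i = z i"
      then have "L y = L z"
        by (intro blinfun_eqI) (auto simp: L less_Suc_eq intro!: multilinear_form_cong[OF A])
      then show "\<phi> (L y) = \<phi> (L z)" by simp
    next
      fix i and y :: "nat \<Rightarrow> 'a" assume i: "i < m"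
      then have sw: "A (y(i := v, m := w)) = A (y(m := w, i := v))" for v w
        by (simp add: fun_upd_twist)
      have "L (y(i := v + w)) = L (y(i := v)) + L (y(i := w))" for v w
        by (intro blinfun_eqI)
          (simp add: L blinfun.add_left sw linear_add[OF lin[OF less_imp_le[OF i]]])
      moreover have "L (y(i := c *\<^sub>R v)) = c *\<^sub>R L (y(i := v))" for c v
        by (intro blinfun_eqI)
          (simp add: L blinfun.scaleR_left sw linear_scale[OF lin[OF less_imp_le[OF i]]])
      ultimately show "linear (\<lambda>v. \<phi> (L (y(i := v))))"
        by (simp add: linear_iff \<phi>.add \<phi>.scaleR)
    qed
    moreover have "\<bar>\<phi> (L y)\<bar> \<le> (C * K) * (\<Prod>i<m. norm (y i))" for y
      using C(1)[of "L y"] mult_right_mono[OF L_norm[of y] C(2)] by (simp add: mult_ac)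
    ultimately have "bounded_form m (\<lambda>y. \<phi> (L y))" by (auto simp: bounded_form_def)
    then show "(\<lambda>j. \<phi> (f j)) \<longlonglongrightarrow> 0"
      unfolding f_def m_def by (rule Suc.IH)
  qed
  moreover have "norm (f j) \<le> K" for j
  proof -
    have "(\<Prod>i<m. norm (x j)) \<le> 1" using x(3) by (simp add: power_le_one)
    then show ?thesis
      using L_norm[of "\<lambda>_. x j"] mult_left_mono[of "\<Prod>i<m. norm (x j)" 1 K]
      by (simp add: f_def K_def)
  qed
  ultimately have "(\<lambda>j. blinfun_apply (f j) (x j)) \<longlonglongrightarrow> 0"
    by (rule weak_dunford_pettis_functionals[OF wdp x(1,2)])
  moreover have "blinfun_apply (f j) (x j) = A (\<lambda>_. x j)" for j
    by (simp add: f_def L fun_upd_idem)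
  ultimately show ?case by simp
qed

lemma disjoint_schur_if_polynomial_schur:
  assumes wdp: "weak_dunford_pettis_property TYPE('a::banach_lattice)"
    and poly: "positive_polynomial_schur_property TYPE('a)"
  shows "disjoint_schur_property TYPE('a)"
  unfolding disjoint_schur_property_def
proof (intro allI impI, elim conjE)
  fix x :: "nat \<Rightarrow> 'a"
  assume x: "\<forall>j. 0 \<le> x j" "pairwise_disjoint_seq x" "weakly_null x"
  define y where "y n = cut_to_unit_ball (x n)" for n
  have y: "0 \<le> y n" "y n \<le> x n" "norm (y n) \<le> 1" for n
    using x(1) by (simp_all add: y_def cut_to_unit_ball_bounds norm_cut_to_unit_ball)
  have "weakly_null y"
    unfolding y_def using x by (simp add: weakly_null_cut_to_unit_ball)
  moreover have "pairwise_disjoint_seq y"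
    using x(1,2) y inf_eq_0_mono[OF _ y(1,2) y(1,2)] by (simp add: pairwise_disjoint_seq_def)
  ultimately have pos: "(\<lambda>j. P (y j)) \<longlonglongrightarrow> 0" if "positive_polynomial n P" "1 \<le> n" for n P
  proof -
    obtain A where A: "polynomial_of_form n A P" "\<And>x. (\<forall>i<n. 0 \<le> x i) \<Longrightarrow> 0 \<le> A x"
      using \<open>positive_polynomial n P\<close> unfolding positive_polynomial_def by blast
    then have "bounded_form n A"
      by (intro positive_form_bounded) (auto simp: polynomial_of_form_def symmetric_multilinear_form_def)
    then have "(\<lambda>j. A (\<lambda>_. y j)) \<longlonglongrightarrow> 0"
      using bounded_form_tendsto_0[OF wdp \<open>weakly_null y\<close> \<open>pairwise_disjoint_seq y\<close> y(3), of "n - 1" A] \<open>1 \<le> n\<close>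
      by simp
    then show ?thesis using A(1) by (simp add: polynomial_of_form_def)
  qed
  have "(\<lambda>j. P (y j)) \<longlonglongrightarrow> 0" if "regular_polynomial n P" "1 \<le> n" for n P
  proof -
    obtain Q R where "positive_polynomial n Q" "positive_polynomial n R" "\<And>v. P v = Q v - R v"
      using \<open>regular_polynomial n P\<close> unfolding regular_polynomial_def by blast
    then show ?thesis using tendsto_diff[OF pos pos, of n Q n R] \<open>1 \<le> n\<close> by simp
  qed
  then have "y \<longlonglongrightarrow> 0"
    using poly y(1) unfolding positive_polynomial_schur_property_def by blast
  then show "x \<longlonglongrightarrow> 0" unfolding y_def by (rule tendsto_0_if_cut_tendsto_0)
qed

lemma polynomial_of_linear_form:
  assumes "linear f"
  shows "polynomial_of_form 1 (\<lambda>x. f (x 0)) f"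
proof -
  have "\<pi> = id" if "\<pi> permutes {..<Suc 0}" for \<pi> :: "nat \<Rightarrow> nat"
    using that by (simp add: lessThan_Suc)
  then show ?thesis
    using assms
    by (auto simp: polynomial_of_form_def symmetric_multilinear_form_def multilinear_form_def
        dest!: \<open>\<And>\<pi>. \<pi> permutes {..<Suc 0} \<Longrightarrow> \<pi> = id\<close>)
qed

lemma regular_polynomial_of_functional:
  fixes f :: "'a::banach_lattice \<Rightarrow> real"
  assumes f: "bounded_linear f"
  shows "regular_polynomial 1 f"
proof -
  obtain g h where gh: "positive_functional g" "positive_functional h" "\<And>x. f x = g x - h x"
    using functional_difference_positive[OF f] by blast
  have "positive_polynomial 1 g" if "positive_functional g" for g :: "'a \<Rightarrow> real"
    using polynomial_of_linear_form[OF positive_functional_linear[OF that]]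
      positive_functional_nonneg[OF that]
    unfolding positive_polynomial_def by (intro exI[of _ "\<lambda>x. g (x 0)"]) simp
  then show ?thesis
    using gh polynomial_of_linear_form[OF bounded_linear.linear[OF f]]
    unfolding regular_polynomial_def homogeneous_polynomial_def by blast
qed

lemma polynomial_schur_if_positive_schur:
  assumes "positive_schur_property TYPE('a::banach_lattice)"
  shows "positive_polynomial_schur_property TYPE('a)"
  using assms regular_polynomial_of_functional
  unfolding positive_polynomial_schur_property_def positive_schur_property_def weakly_null_def
  by blast

lemma weak_dunford_pettis_if_positive_schur:
  assumes "positive_schur_property TYPE('a::banach_lattice)"
  shows "weak_dunford_pettis_property TYPE('a)"
  unfolding weak_dunford_pettis_property_def weak_dunford_pettis_into_def
proof (intro allI impI, elim conjE)
  fix F :: "(nat \<Rightarrow> 'a) normed_structure" and T :: "'a \<Rightarrow> nat \<Rightarrow> 'a" and x :: "nat \<Rightarrow> 'a"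
  assume F: "banach_space F" and T: "weakly_compact_operator F T"
    and x: "weakly_null x" "pairwise_disjoint_seq x"
  have "(\<lambda>j. \<bar>x j\<bar>) \<longlonglongrightarrow> 0"
    using assms weakly_null_abs_disjoint[OF x(2,1)] by (simp add: positive_schur_property_def)
  then have lim: "(\<lambda>j. norm (x j)) \<longlonglongrightarrow> 0" using tendsto_norm_zero by fastforce
  have bounded: "bounded_operator F T" using T by (simp add: weakly_compact_operator_def)
  then obtain K where K: "\<And>v. vnorm F (T v) \<le> K * norm v"
    unfolding bounded_operator_def by blast
  have p: "T v \<in> pts F" for v using bounded by (simp add: bounded_operator_def)
  have "(\<lambda>j. K * norm (x j)) \<longlonglongrightarrow> 0" using lim by (rule tendsto_mult_right_zero)
  moreover have "\<forall>\<^sub>F j in sequentially. norm (vnorm F (T (x j))) \<le> K * norm (x j)"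
    using K banach_space.norm_nonneg[OF F p] by (intro always_eventually) simp
  ultimately show "(\<lambda>j. vnorm F (T (x j))) \<longlonglongrightarrow> 0"
    by (rule Lim_null_comparison[rotated])
qed

theorem theorem4p4:
  shows "positive_schur_property TYPE('a::banach_lattice) \<longleftrightarrow>
    weak_dunford_pettis_property TYPE('a) \<and> positive_polynomial_schur_property TYPE('a)"
  using weak_dunford_pettis_if_positive_schur polynomial_schur_if_positive_schur
    positive_schur_if_disjoint_schur disjoint_schur_if_polynomial_schur
  by blast

end
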